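(* Let $f \in \mathbb{C}[x_1,\dots,x_n]_d$ with $\underline{\mathsf{WR}}(f) = r$. Then $\mathsf{WR}(f) \le \binom{2r-2}{r-1}\cdot d$.
   Context: $\mathsf{WR}(f)$ is the Waring rank: the smallest $s$ with $f=\sum_{k=1}^s\ell_k^d$ for linear forms $\ell_k$. $\underline{\mathsf{WR}}(f)$ is the border Waring rank: the smallest $s$ with $f=\lim_{\epsilon\to0}\sum_{k=1}^s\ell_k(\epsilon)^d$ for linear forms $\ell_k(\epsilon)$ whose coefficients are rational functions of $\epsilon$. *)

theory Defs
  imports "HOL-Analysis.Analysis" "HOL-Computational_Algebra.Polynomial"
begin

text \<open>Forms in n variables over the complex numbers are represented by their
  polynomial functions on complex^'n (over the infinite field C a polynomial
  is determined by its function). The number of variables is CARD('n).\<close>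

definition lin_form :: "complex ^ 'n \<Rightarrow> complex ^ 'n \<Rightarrow> complex" where
  "lin_form a x = (\<Sum>i\<in>UNIV. a $ i * x $ i)"

definition is_form :: "nat \<Rightarrow> (complex ^ 'n \<Rightarrow> complex) \<Rightarrow> bool" where
  "is_form d f \<longleftrightarrow> (\<exists>c :: ('n \<Rightarrow> nat) \<Rightarrow> complex.
     \<forall>x. f x = (\<Sum>\<alpha>\<in>{\<alpha> :: 'n \<Rightarrow> nat. sum \<alpha> UNIV = d}. c \<alpha> * (\<Prod>i\<in>UNIV. (x $ i) ^ \<alpha> i)))"

definition waring_decomp :: "nat \<Rightarrow> (complex ^ 'n \<Rightarrow> complex) \<Rightarrow> nat \<Rightarrow> bool" where
  "waring_decomp d f s \<longleftrightarrow> (\<exists>l :: nat \<Rightarrow> complex ^ 'n.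
     \<forall>x. f x = (\<Sum>k<s. (lin_form (l k) x) ^ d))"

definition WR :: "nat \<Rightarrow> (complex ^ 'n \<Rightarrow> complex) \<Rightarrow> nat" where
  "WR d f = (LEAST s. waring_decomp d f s)"

definition rational_fun :: "(complex \<Rightarrow> complex) \<Rightarrow> bool" where
  "rational_fun c \<longleftrightarrow> (\<exists>p q :: complex poly. q \<noteq> 0 \<and> c = (\<lambda>e. poly p e / poly q e))"

definition border_decomp :: "nat \<Rightarrow> (complex ^ 'n \<Rightarrow> complex) \<Rightarrow> nat \<Rightarrow> bool" where
  "border_decomp d f s \<longleftrightarrow> (\<exists>l :: nat \<Rightarrow> complex \<Rightarrow> complex ^ 'n.
     (\<forall>k<s. \<forall>i. rational_fun (\<lambda>e. l k e $ i)) \<and>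
     (\<forall>x. ((\<lambda>e. \<Sum>k<s. (lin_form (l k e) x) ^ d) \<longlongrightarrow> f x) (at 0)))"

definition border_WR :: "nat \<Rightarrow> (complex ^ 'n \<Rightarrow> complex) \<Rightarrow> nat" where
  "border_WR d f = (LEAST s. border_decomp d f s)"

end

theory Submission
  imports Defs "HOL-Library.Function_Algebras" "HOL-Library.Multiset"
begin

text \<open>
  Take an ultrafilter converging to \<open>0\<close>, so that bounded quantities have limits, and let \<open>f\<close> be the limit
  of \<open>\<Sum>k<r. c k * (u k) ^ d\<close>, where all \<open>u k\<close> take the value \<open>1\<close> at a common vector \<open>y\<close> and converge
  to \<open>p k\<close>. The \<open>r\<close> forms span a space of dimension at most \<open>r\<close>, and in the limit \<open>f\<close> depends on at most
  \<open>r\<close> linear forms \<open>w i\<close>.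

  If \<open>d \<ge> r - 1\<close>, then \<open>f\<close> is a sum, over the distinct points \<open>q\<close> among the \<open>p k\<close>, of terms
  \<open>q ^ (d - b + 1) * g\<close> with \<open>g\<close> of degree \<open>b - 1\<close> and \<open>b\<close> the multiplicity of \<open>q\<close>. If all limit points
  agree, this holds because the product of the vectors \<open>a k - u k (a k) * y\<close> annihilates every summand;
  otherwise a linear function separating two limit points writes the family as a combination of two
  families with one point less. Here \<open>g\<close> lies in the span of the powers \<open>m ^ (b - 1)\<close> with \<open>m\<close> in the span
  of the \<open>w i\<close>, a space of dimension at most \<open>(r + b - 2) choose (b - 1)\<close>; these dimensions add up to at most
  \<open>(2 * r - 2) choose (r - 1)\<close>, and each binary form \<open>q ^ (d - b + 1) * m ^ (b - 1)\<close> is a sum of \<open>d\<close>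
  powers. If \<open>d < r\<close>, the space of all forms of degree \<open>d\<close> in \<open>r\<close> variables is already small enough.
\<close>

subsection \<open>Spans of complex-valued functions\<close>

text \<open>Forms are treated as functions, so spans of functions stand in for spaces of
  polynomials.\<close>

global_interpretation fs: vector_space "\<lambda>(c::complex) (f::'a \<Rightarrow> complex) x. c * f x"
  defines fspan = fs.span
  by unfold_locales (auto simp: fun_eq_iff algebra_simps)

lemma fspan_add: "f \<in> fspan S \<Longrightarrow> g \<in> fspan S \<Longrightarrow> (\<lambda>x. f x + g x) \<in> fspan S"
  using fs.span_add[of f S g] by (simp add: plus_fun_def)

lemma fspan_diff: "f \<in> fspan S \<Longrightarrow> g \<in> fspan S \<Longrightarrow> (\<lambda>x. f x - g x) \<in> fspan S"
  using fs.span_diff[of f S g] by (simp add: fun_diff_def)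

lemma fspan_zero: "(\<lambda>x. 0) \<in> fspan S"
  using fs.span_zero[of S] by (simp add: zero_fun_def)

lemma fspan_scale: "f \<in> fspan S \<Longrightarrow> (\<lambda>x. c * f x) \<in> fspan S"
  using fs.span_scale[of f S c] by simp

lemma fspan_sum: "(\<And>i. i \<in> I \<Longrightarrow> f i \<in> fspan S) \<Longrightarrow> (\<lambda>x. \<Sum>i\<in>I. f i x) \<in> fspan S"
  by (induction I rule: infinite_finite_induct) (auto intro: fspan_zero fspan_add)

text \<open>The map from \<open>f\<close> to \<open>g * (f o h)\<close> is linear, so generators
  suffice. It serves both for multiplication by a fixed factor and for a substitution of
  variables.\<close>

lemma fspan_linear_image:
  assumes "f \<in> fspan S" "\<And>s. s \<in> S \<Longrightarrow> (\<lambda>x. g x * s (h x)) \<in> fspan T"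
  shows "(\<lambda>x. g x * f (h x)) \<in> fspan T"
  using assms(1)
proof (induction rule: fs.span_induct_alt)
  case base
  then show ?case by (simp add: fspan_zero)
next
  case (step c s f)
  have "(\<lambda>x. c * (g x * s (h x)) + g x * f (h x)) \<in> fspan T"
    by (intro fspan_add fspan_scale assms(2) step)
  then show ?case by (simp add: algebra_simps)
qed

lemma fspan_trans: "f \<in> fspan S \<Longrightarrow> (\<And>s. s \<in> S \<Longrightarrow> s \<in> fspan T) \<Longrightarrow> f \<in> fspan T"
  using fspan_linear_image[of f S "\<lambda>_. 1" "\<lambda>x. x" T] by simp

text \<open>For \<open>P t = (\<Sum>i\<le>N. t ^ i * u i)\<close>, the combination \<open>P (2 * t) - 2 ^ N * P t\<close> has no top coefficient.\<close>

lemma fspan_coefficient: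
  fixes u :: "nat \<Rightarrow> 'a \<Rightarrow> complex"
  assumes "\<And>t. (\<lambda>x. \<Sum>i\<le>N. t ^ i * u i x) \<in> fspan S" "i \<le> N"
  shows "u i \<in> fspan S"
  using assms
proof (induction N arbitrary: u i)
  case 0
  then show ?case using 0(1)[of 1] by simp
next
  case (Suc N)
  have lower: "u j \<in> fspan S" if "j \<le> N" for j
  proof -
    have "(\<lambda>x. \<Sum>i\<le>N. t ^ i * ((2 ^ i - 2 ^ Suc N) * u i x)) \<in> fspan S" for t
    proof -
      have "(\<lambda>x. (\<Sum>i\<le>Suc N. (2 * t) ^ i * u i x) - 2 ^ Suc N * (\<Sum>i\<le>Suc N. t ^ i * u i x)) \<in> fspan S"
        by (intro fspan_diff fspan_scale Suc.prems(1))
      also have "(\<lambda>x. (\<Sum>i\<le>Suc N. (2 * t) ^ i * u i x) - 2 ^ Suc N * (\<Sum>i\<le>Suc N. t ^ i * u i x)) =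
          (\<lambda>x. \<Sum>i\<le>N. t ^ i * ((2 ^ i - 2 ^ Suc N) * u i x))"
        by (simp add: fun_eq_iff power_mult_distrib sum_distrib_left sum_subtractf algebra_simps)
      finally show ?thesis .
    qed
    from Suc.IH[OF this that] have "(\<lambda>x. (2 ^ j - 2 ^ Suc N) * u j x) \<in> fspan S" .
    from fspan_scale[OF this, of "1 / (2 ^ j - 2 ^ Suc N)"]
    have "(\<lambda>x. 1 / (2 ^ j - 2 ^ Suc N) * ((2 ^ j - 2 ^ Suc N) * u j x)) \<in> fspan S" .
    moreover have "(2 ^ j - 2 ^ Suc N :: complex) \<noteq> 0"
    proof
      assume "(2 ^ j - 2 ^ Suc N :: complex) = 0"
      then have "(of_nat (2 ^ j) :: complex) = of_nat (2 ^ Suc N)" by simp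
      then have "(2::nat) ^ j = 2 ^ Suc N" by (simp only: of_nat_eq_iff)
      then show False using that by (simp only: power_inject_exp)
    qed
    ultimately show ?thesis by simp
  qed
  show ?case
  proof (cases "i \<le> N")
    case False
    then have i: "i = Suc N" using Suc.prems by simp
    have "(\<lambda>x. (\<Sum>i\<le>Suc N. 1 ^ i * u i x) - (\<Sum>i\<le>N. u i x)) \<in> fspan S"
      by (intro fspan_diff fspan_sum Suc.prems(1) lower) simp
    then show ?thesis by (simp add: i)
  qed (rule lower)
qed

subsection \<open>Linear forms and their products\<close>

lemma lin_form_add: "lin_form (a + b) x = lin_form a x + lin_form b x"
  by (simp add: lin_form_def sum.distrib algebra_simps)

lemma lin_form_scale: "lin_form (c *s a) x = c * lin_form a x"
  by (simp add: lin_form_def sum_distrib_left algebra_simps)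

lemma lin_form_commute: "lin_form a x = lin_form x a"
  by (simp add: lin_form_def mult.commute)

lemma lin_form_diff: "lin_form (a - b) x = lin_form a x - lin_form b x"
  by (simp add: lin_form_def sum_subtractf algebra_simps)

lemma lin_form_zero: "lin_form 0 x = 0"
  by (simp add: lin_form_def)

lemma lin_form_sum: "lin_form (\<Sum>i\<in>I. a i) x = (\<Sum>i\<in>I. lin_form (a i) x)"
  by (induction I rule: infinite_finite_induct) (auto simp: lin_form_zero lin_form_add)

lemma lin_form_axis: "lin_form (axis i 1) x = x $ i"
  by (simp add: lin_form_def axis_def if_distrib if_distribR cong: if_cong)

lemma lin_form_axis_right: "lin_form x (axis i 1) = x $ i"
  by (simp add: lin_form_commute[of x] lin_form_axis)

text \<open>Since \<open>lin_form\<close> is symmetric in its two arguments, this is read in two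
  ways: as a product of linear forms in \<open>x\<close>, and as the power of the form
  \<open>x\<close> polarised and evaluated at the vectors in \<open>M\<close>.\<close>

definition lin_prod :: "(complex ^ 'n) multiset \<Rightarrow> complex ^ 'n \<Rightarrow> complex" where
  "lin_prod M x = (\<Prod>m\<in>#M. lin_form m x)"

lemma lin_prod_simps [simp]:
  "lin_prod {#} x = 1"
  "lin_prod (add_mset m M) x = lin_form m x * lin_prod M x"
  "lin_prod (M + N) x = lin_prod M x * lin_prod N x"
  "lin_prod (replicate_mset k m) x = lin_form m x ^ k"
  by (simp_all add: lin_prod_def)

text \<open>Polarisation: in the power of \<open>t *s m + l\<close> the coefficient of
  \<open>t\<close> trades one factor \<open>l\<close> for the factor \<open>m\<close>, and
  \<open>fspan_coefficient\<close> extracts it. The factor \<open>g\<close> is carried along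
  unchanged.\<close>

lemma lin_prod_power_in_span:
  fixes g :: "complex ^ 'n \<Rightarrow> complex"
  assumes "size M \<le> d"
  shows "(\<lambda>x. g x * (lin_form l x ^ (d - size M) * lin_prod M x))
    \<in> fspan {\<lambda>x. g x * lin_form m x ^ d | m. True}" (is "_ \<in> fspan ?S")
  using assms
proof (induction M arbitrary: l)
  case empty
  show ?case by (intro fs.span_base) auto
next
  case (add m M)
  define N where "N = d - size M"
  define u where "u i x = g x * (of_nat (N choose i) * lin_form m x ^ i * lin_form l x ^ (N - i) * lin_prod M x)" for i x
  have "(\<lambda>x. \<Sum>i\<le>N. t ^ i * u i x) \<in> fspan ?S" for t
  proof -
    have "(\<lambda>x. g x * (lin_form (t *s m + l) x ^ N * lin_prod M x)) \<in> fspan ?S"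
      using add by (simp add: N_def)
    also have "(\<lambda>x. g x * (lin_form (t *s m + l) x ^ N * lin_prod M x)) = (\<lambda>x. \<Sum>i\<le>N. t ^ i * u i x)"
      by (simp add: fun_eq_iff u_def lin_form_add lin_form_scale binomial_ring sum_distrib_left sum_distrib_right
          power_mult_distrib mult_ac)
    finally show ?thesis .
  qed
  from fspan_coefficient[OF this] have u: "u i \<in> fspan ?S" if "i \<le> N" for i using that .
  have N: "1 \<le> N" and exponent: "d - size (add_mset m M) = N - 1"
    using add.prems by (simp_all add: N_def)
  from fspan_scale[OF u[OF N], of "1 / of_nat N"]
  have "(\<lambda>x. 1 / of_nat N * u 1 x) \<in> fspan ?S" .
  also have "(\<lambda>x. 1 / of_nat N * u 1 x) = (\<lambda>x. g x * (lin_form l x ^ (d - size (add_mset m M)) * lin_prod (add_mset m M) x))"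
    using N exponent by (auto simp: fun_eq_iff u_def mult_ac)
  finally show ?case .
qed

lemma lin_prod_in_span:
  "(\<lambda>x. g x * lin_prod M x) \<in> fspan {\<lambda>x. g x * lin_form m x ^ size M | m. True}"
  using lin_prod_power_in_span[of M "size M" g 0] by simp

subsection \<open>Ultrafilters\<close>

text \<open>By Zorn there is a minimal proper filter below \<open>F\<close>. Restricting it to a
  predicate either destroys it or, by minimality, changes nothing, so it decides every
  predicate.\<close>

lemma exists_ultrafilter:
  fixes F :: "'a filter"
  assumes "F \<noteq> bot"
  obtains U where "U \<le> F" "U \<noteq> bot" "\<And>P. eventually P U \<or> eventually (\<lambda>x. \<not> P x) U"
proof -
  define A where "A = {G. G \<le> F \<and> G \<noteq> bot}"
  have "\<exists>m\<in>A. \<forall>a\<in>A. m \<ge> a \<longrightarrow> a = m"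
  proof (rule predicate_Zorn)
    show "partial_order_on A (relation_of (\<lambda>x y. x \<ge> y) A)"
      by (rule partial_order_on_relation_ofI) auto
  next
    fix C assume C: "C \<in> Chains (relation_of (\<lambda>x y. y \<le> x) A)"
    then have CA: "C \<subseteq> A" and tot: "\<And>a b. a \<in> C \<Longrightarrow> b \<in> C \<Longrightarrow> a \<le> b \<or> b \<le> a"
      by (auto simp: Chains_def relation_of_def)
    show "\<exists>u\<in>A. \<forall>a\<in>C. u \<le> a"
    proof (cases "C = {}")
      case True
      then show ?thesis using assms by (auto simp: A_def)
    next
      case False
      \<comment> \<open>In a chain every finite nonempty infimum is a member, hence proper; an
        infimum of filters is proper once all finite infima are.\<close>
      have fin: "X \<subseteq> C \<Longrightarrow> X \<noteq> {} \<Longrightarrow> Inf X \<in> C" if "finite X" for X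
        using that
      proof (induction rule: finite_induct)
        case (insert x X)
        show ?case
        proof (cases "X = {}")
          case False
          then have "x \<in> C" "Inf X \<in> C" using insert by auto
          then show ?thesis using tot[of x "Inf X"] by (auto simp: inf.absorb1 inf.absorb2)
        qed (use insert in auto)
      qed auto
      have "Inf C \<noteq> bot"
      proof (rule Inf_filter_not_bot)
        fix X assume X: "X \<subseteq> C" "finite X"
        show "Inf X \<noteq> bot"
        proof (cases "X = {}")
          case True
          then have "F \<le> Inf X" by (intro Inf_greatest) simp
          then show ?thesis using assms by (metis bot_unique)
        next
          case False
          then show ?thesis using fin[OF X(2) X(1)] CA by (auto simp: A_def)
        qed
      qed
      moreover have "Inf C \<le> F" using False CA by (auto simp: A_def intro: Inf_lower2)
      ultimately show ?thesis by (intro bexI[of _ "Inf C"]) (auto simp: A_def Inf_lower)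
    qed
  qed
  then obtain U where U: "U \<in> A" "\<And>G. G \<in> A \<Longrightarrow> G \<le> U \<Longrightarrow> G = U" by blast
  show thesis
  proof
    show "U \<le> F" "U \<noteq> bot" using U by (auto simp: A_def)
    fix P
    show "eventually P U \<or> eventually (\<lambda>x. \<not> P x) U"
    proof (cases "inf U (principal {x. P x}) = bot")
      case True
      then have "eventually (\<lambda>x. \<not> P x) U"
        by (simp add: trivial_limit_def eventually_inf_principal)
      then show ?thesis ..
    next
      case False
      moreover have "inf U (principal {x. P x}) \<le> F" using U(1) by (auto simp: A_def intro: le_infI1)
      ultimately have "inf U (principal {x. P x}) = U" using U(2) by (auto simp: A_def)
      then have "U \<le> principal {x. P x}" by (metis inf.cobounded2)
      then show ?thesis by (simp add: le_principal)
    qed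
  qed
qed

text \<open>Compactness yields a cluster point, and an ultrafilter converges to each of its cluster
  points.\<close>

lemma ultrafilter_bounded_convergent:
  fixes g :: "'a \<Rightarrow> 'b::heine_borel"
  assumes U: "U \<noteq> bot" "\<And>P. eventually P U \<or> eventually (\<lambda>x. \<not> P x) U"
    and "bounded S" "\<And>x. g x \<in> S"
  shows "\<exists>l. (g \<longlongrightarrow> l) U"
proof -
  have "compact (closure S)" using assms(3) by (simp add: compact_closure)
  moreover have "filtermap g U \<noteq> bot" using U(1) by (simp add: filtermap_bot_iff)
  moreover have "eventually (\<lambda>y. y \<in> closure S) (filtermap g U)"
    using assms(4) closure_subset[of S] by (auto simp: eventually_filtermap intro!: always_eventually)
  ultimately obtain l where l: "inf (nhds l) (filtermap g U) \<noteq> bot"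
    unfolding compact_filter by blast
  have "(g \<longlongrightarrow> l) U"
  proof (rule topological_tendstoI)
    fix T assume T: "open T" "l \<in> T"
    have False if "eventually (\<lambda>x. g x \<notin> T) U"
    proof -
      have "eventually (\<lambda>y. y \<in> T) (nhds l)" using T by (rule eventually_nhds_in_open)
      moreover have "eventually (\<lambda>y. y \<notin> T) (filtermap g U)" using that by (simp add: eventually_filtermap)
      ultimately have "eventually (\<lambda>y. False) (inf (nhds l) (filtermap g U))"
        unfolding eventually_inf by blast
      then show False using l by (simp add: trivial_limit_def)
    qed
    then show "eventually (\<lambda>x. g x \<in> T) U" using U(2)[of "\<lambda>x. g x \<in> T"] by blast
  qed
  then show ?thesis ..
qed

subsection \<open>Convergent families of moments\<close>

lemma tendsto_lin_form:
  assumes "(f \<longlongrightarrow> a) F" "(g \<longlongrightarrow> b) F"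
  shows "((\<lambda>e. lin_form (f e) (g e)) \<longlongrightarrow> lin_form a b) F"
  unfolding lin_form_def by (intro tendsto_intros assms)

lemma tendsto_vector_scalar_mult:
  fixes f :: "'e \<Rightarrow> complex ^ 'n"
  assumes "(c \<longlongrightarrow> c0) F" "(f \<longlongrightarrow> a) F"
  shows "((\<lambda>e. c e *s f e) \<longlongrightarrow> c0 *s a) F"
  by (rule vec_tendstoI) (simp, intro tendsto_intros assms)

lemma lin_prod_image: "lin_prod (image_mset f (mset_set I)) x = (\<Prod>i\<in>I. lin_form (f i) x)"
  by (simp add: lin_prod_def prod_unfold_prod_mset image_mset.compositionality comp_def)

text \<open>\<open>mom K c u Z\<close> is the polarisation of \<open>\<Sum>k\<in>K. c k * (lin_form (u k)) ^ d\<close>, evaluated at the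
  \<open>d = size Z\<close> vectors in \<open>Z\<close>.\<close>

definition mom :: "nat set \<Rightarrow> (nat \<Rightarrow> 'e \<Rightarrow> complex) \<Rightarrow> (nat \<Rightarrow> 'e \<Rightarrow> complex ^ 'n)
    \<Rightarrow> (complex ^ 'n) multiset \<Rightarrow> 'e \<Rightarrow> complex" where
  "mom K c u Z e = (\<Sum>k\<in>K. c k e * lin_prod Z (u k e))"

lemma mom_add_mset_expand:
  "mom K c u (add_mset z Z) e = (\<Sum>b\<in>UNIV. z $ b * mom K c u (add_mset (axis b 1) Z) e)"
proof -
  have "lin_form z x = (\<Sum>b\<in>UNIV. z $ b * lin_form (axis b 1) x)" for x
    by (simp add: lin_form_axis) (simp add: lin_form_def)
  then have "mom K c u (add_mset z Z) e =
      (\<Sum>k\<in>K. \<Sum>b\<in>UNIV. z $ b * (c k e * (lin_form (axis b 1) (u k e) * lin_prod Z (u k e))))"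
    by (simp add: mom_def sum_distrib_left sum_distrib_right mult_ac)
  also have "\<dots> = (\<Sum>b\<in>UNIV. z $ b * mom K c u (add_mset (axis b 1) Z) e)"
    by (subst sum.swap) (simp add: mom_def sum_distrib_left)
  finally show ?thesis .
qed

lemma mom_limit_expand:
  assumes "F \<noteq> bot" "\<And>Z. size Z = n \<Longrightarrow> (mom K c u Z \<longlongrightarrow> T Z) F" "Suc (size Z) = n"
  shows "T (add_mset z Z) = (\<Sum>b\<in>UNIV. z $ b * T (add_mset (axis b 1) Z))"
proof (rule tendsto_unique[OF assms(1)])
  show "(mom K c u (add_mset z Z) \<longlongrightarrow> T (add_mset z Z)) F"
    using assms by simp
  have "((\<lambda>e. \<Sum>b\<in>UNIV. z $ b * mom K c u (add_mset (axis b 1) Z) e) \<longlongrightarrow>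
      (\<Sum>b\<in>UNIV. z $ b * T (add_mset (axis b 1) Z))) F"
    using assms by (intro tendsto_intros) simp
  also have "(\<lambda>e. \<Sum>b\<in>UNIV. z $ b * mom K c u (add_mset (axis b 1) Z) e) = mom K c u (add_mset z Z)"
    by (rule ext) (rule mom_add_mset_expand[symmetric])
  finally show "(mom K c u (add_mset z Z) \<longlongrightarrow> (\<Sum>b\<in>UNIV. z $ b * T (add_mset (axis b 1) Z))) F" .
qed

text \<open>By multilinearity each moving vector expands in the fixed coordinate vectors, so only
  finitely many fixed moments occur, with convergent coefficients.\<close>

lemma mom_tendsto_moving:
  assumes "F \<noteq> bot" "\<And>Z. size Z = n \<Longrightarrow> (mom K c u Z \<longlongrightarrow> T Z) F"
    and "finite I" "\<And>i. i \<in> I \<Longrightarrow> (z i \<longlongrightarrow> z0 i) F" "card I + size Z = n"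
  shows "((\<lambda>e. mom K c u (image_mset (\<lambda>i. z i e) (mset_set I) + Z) e)
    \<longlongrightarrow> T (image_mset z0 (mset_set I) + Z)) F"
  using assms(3-)
proof (induction I arbitrary: Z rule: finite_induct)
  case empty
  then show ?case using assms(2) by simp
next
  case (insert i I)
  have "((\<lambda>e. \<Sum>b\<in>UNIV. z i e $ b * mom K c u (image_mset (\<lambda>i. z i e) (mset_set I) + add_mset (axis b 1) Z) e)
      \<longlongrightarrow> (\<Sum>b\<in>UNIV. z0 i $ b * T (image_mset z0 (mset_set I) + add_mset (axis b 1) Z))) F"
    using insert by (intro tendsto_intros insert.IH) auto
  moreover have "T (image_mset z0 (mset_set (insert i I)) + Z) =
      (\<Sum>b\<in>UNIV. z0 i $ b * T (image_mset z0 (mset_set I) + add_mset (axis b 1) Z))"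
    using insert mom_limit_expand[OF assms(1,2), where Z = "image_mset z0 (mset_set I) + Z" and z = "z0 i"] by simp
  moreover have "mom K c u (image_mset (\<lambda>i. z i e) (mset_set (insert i I)) + Z) e =
      (\<Sum>b\<in>UNIV. z i e $ b * mom K c u (image_mset (\<lambda>i. z i e) (mset_set I) + add_mset (axis b 1) Z) e)" for e
    using insert mom_add_mset_expand[of K c u "z i e" "image_mset (\<lambda>i. z i e) (mset_set I) + Z" e] by simp
  ultimately show ?case by simp
qed

text \<open>This assigns one vector of \<open>Z\<close> to each point of the family, as needed to
  apply \<open>mom_vanish\<close>.\<close>

lemma multiset_split_indexed:
  assumes "finite K" "card K \<le> size Z"
  shows "\<exists>a R. Z = image_mset a (mset_set K) + R"
  using assms
proof (induction K rule: finite_induct)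
  case empty
  then show ?case by auto
next
  case (insert k K)
  then obtain a R where Z: "Z = image_mset a (mset_set K) + R" by fastforce
  with insert have "size R > 0" by auto
  then obtain r R' where R: "R = add_mset r R'" by (metis less_irrefl multiset_cases size_empty)
  have "image_mset (a(k := r)) (mset_set K) = image_mset a (mset_set K)"
    by (rule image_mset_cong) (use insert in auto)
  then have "Z = image_mset (a(k := r)) (mset_set (insert k K)) + R'"
    using insert by (simp add: Z R)
  then show ?case by blast
qed

section \<open>Families normalised at a common vector: convergence in all degrees and the shape of
  the limits\<close>

context
  fixes F :: "'e filter" and y :: "complex ^ 'n" and u :: "nat \<Rightarrow> 'e \<Rightarrow> complex ^ 'n"
    and p :: "nat \<Rightarrow> complex ^ 'n"
  assumes F: "F \<noteq> bot"
    and uy: "\<And>k e. lin_form y (u k e) = 1"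
    and up: "\<And>k. (u k \<longlongrightarrow> p k) F"
begin

text \<open>All points lie in the affine chart where \<open>y\<close> has value \<open>1\<close>, so
  moments of low degree are among those of any higher degree.\<close>

lemma mom_replicate_homogenizer: "mom K c u (replicate_mset i y + Z) e = mom K c u Z e"
  by (simp add: mom_def uy)

text \<open>The vector attached to the index \<open>k\<close> is annihilated by
  \<open>u k e\<close>, so each summand has a zero factor of its own.\<close>

lemma mom_vanish:
  assumes "finite K"
  shows "mom K c u (image_mset (\<lambda>k. a k - lin_form (a k) (u k e) *s y) (mset_set K) + R) e = 0"
proof -
  have "(\<Prod>i\<in>K. lin_form (a i - lin_form (a i) (u i e) *s y) (u k e)) = 0" if "k \<in> K" for k
    using that assms by (intro prod_zero) (auto simp: lin_form_diff lin_form_scale uy)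
  then show ?thesis by (simp add: mom_def lin_prod_image)
qed

lemma shift_tendsto:
  "((\<lambda>e. a - lin_form a (u k e) *s y) \<longlongrightarrow> a - lin_form a (p k) *s y) F"
  by (intro tendsto_diff tendsto_vector_scalar_mult tendsto_lin_form tendsto_const up)

text \<open>When the product of shifted vectors is expanded, every term except the unshifted one
  contains \<open>y\<close> and is thus a moment of smaller degree. The induction removes one shift
  at a time.\<close>

lemma mom_shift_convergent:
  assumes "finite I" "\<And>Z. size Z < card I + size R \<Longrightarrow> \<exists>t. (mom K c u Z \<longlongrightarrow> t) F"
  shows "\<exists>t. ((\<lambda>e. mom K c u (image_mset (\<lambda>k. a k - lin_form (a k) (u k e) *s y) (mset_set I) + R) e
    - mom K c u (image_mset a (mset_set I) + R) e) \<longlongrightarrow> t) F"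
  using assms
proof (induction I arbitrary: R rule: finite_induct)
  case empty
  then show ?case by auto
next
  case (insert i I)
  let ?M = "\<lambda>e. image_mset (\<lambda>k. a k - lin_form (a k) (u k e) *s y) (mset_set I)"
  obtain t1 where t1: "((\<lambda>e. mom K c u (?M e + add_mset (a i) R) e
      - mom K c u (image_mset a (mset_set I) + add_mset (a i) R) e) \<longlongrightarrow> t1) F"
    using insert.IH[of "add_mset (a i) R"] insert by fastforce
  obtain T where T: "\<And>Z. size Z = card I + size R \<Longrightarrow> (mom K c u Z \<longlongrightarrow> T Z) F"
    using insert.prems insert.hyps by (metis add_Suc card_insert_disjoint lessI)
  have t2: "((\<lambda>e. mom K c u (?M e + R) e) \<longlongrightarrow>
      T (image_mset (\<lambda>k. a k - lin_form (a k) (p k) *s y) (mset_set I) + R)) F"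
    using insert by (intro mom_tendsto_moving[OF F T] shift_tendsto) auto
  have "((\<lambda>e. (mom K c u (?M e + add_mset (a i) R) e
      - mom K c u (image_mset a (mset_set I) + add_mset (a i) R) e)
      - lin_form (a i) (u i e) * mom K c u (?M e + R) e)
      \<longlongrightarrow> t1 - lin_form (a i) (p i) * T (image_mset (\<lambda>k. a k - lin_form (a k) (p k) *s y) (mset_set I) + R)) F"
    by (intro tendsto_diff tendsto_mult t1 t2 tendsto_lin_form tendsto_const up)
  moreover have "mom K c u (image_mset (\<lambda>k. a k - lin_form (a k) (u k e) *s y) (mset_set (insert i I)) + R) e
    - mom K c u (image_mset a (mset_set (insert i I)) + R) e =
    (mom K c u (?M e + add_mset (a i) R) e
      - mom K c u (image_mset a (mset_set I) + add_mset (a i) R) e)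
      - lin_form (a i) (u i e) * mom K c u (?M e + R) e" for e
    using insert
    by (simp add: mom_def lin_form_diff lin_form_scale uy algebra_simps sum_distrib_left sum_subtractf)
  ultimately show ?case by auto
qed

text \<open>Since \<open>mom_vanish\<close> replaces a product of \<open>card K\<close> vectors by shorter products with convergent
  coefficients, convergence in degree \<open>card K - 1\<close> propagates to all higher degrees.\<close>

lemma mom_convergent_all:
  assumes "finite K" "card K \<le> Suc d"
    and "\<And>Z. size Z = d \<Longrightarrow> \<exists>t. (mom K c u Z \<longlongrightarrow> t) F"
  shows "\<exists>t. (mom K c u Z \<longlongrightarrow> t) F"
proof (induction "size Z" arbitrary: Z rule: less_induct)
  case less
  show ?case
  proof (cases "size Z \<le> d")
    case True
    then show ?thesis
      using assms(3)[of "replicate_mset (d - size Z) y + Z"] by (simp add: mom_replicate_homogenizer[abs_def])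
  next
    case False
    then have "card K \<le> size Z" using assms(2) by simp
    then obtain a R where Z: "Z = image_mset a (mset_set K) + R"
      using multiset_split_indexed assms(1) by blast
    obtain t where "((\<lambda>e. mom K c u (image_mset (\<lambda>k. a k - lin_form (a k) (u k e) *s y) (mset_set K) + R) e
        - mom K c u (image_mset a (mset_set K) + R) e) \<longlongrightarrow> t) F"
      using mom_shift_convergent[OF assms(1), of R K c a] less by (auto simp: Z)
    then have "((\<lambda>e. - mom K c u Z e) \<longlongrightarrow> t) F"
      by (simp add: mom_vanish[OF assms(1)] Z)
    from tendsto_minus[OF this] show ?thesis by auto
  qed
qed

text \<open>Each copy of \<open>\<rho> x\<close> is expanded in coordinates and contributes one
  linear form \<open>m b\<close>; the coordinate vectors accumulate in \<open>Z\<close>, which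
  leaves a constant at the end.\<close>

lemma limit_replicate_in_span:
  fixes \<rho> :: "complex ^ 'n \<Rightarrow> complex ^ 'n"
  assumes T: "\<And>Z. (mom K c u Z \<longlongrightarrow> T Z) F" and \<rho>: "\<And>x b. \<rho> x $ b = lin_form (m b) x"
  shows "(\<lambda>x. T (replicate_mset i (\<rho> x) + Z)) \<in> fspan {lin_prod M | M. size M = i}"
proof (induction i arbitrary: Z)
  case 0
  have "(\<lambda>x. T Z * lin_prod {#} x) \<in> fspan {lin_prod M | M. size M = 0}"
    by (intro fspan_scale fs.span_base) auto
  then show ?case by (simp only: lin_prod_simps mult_1_right replicate_mset_0 add_0)
next
  case (Suc i)
  have "T (replicate_mset (Suc i) (\<rho> x) + Z) =
      (\<Sum>b\<in>UNIV. lin_form (m b) x * T (replicate_mset i (\<rho> x) + add_mset (axis b 1) Z))" for x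
    using mom_limit_expand[OF F T refl, where Z = "replicate_mset i (\<rho> x) + Z" and z = "\<rho> x"] by (simp add: \<rho>)
  moreover have "(\<lambda>x. \<Sum>b\<in>UNIV. lin_form (m b) x * T (replicate_mset i (\<rho> x) + add_mset (axis b 1) Z))
      \<in> fspan {lin_prod M | M. size M = Suc i}"
  proof (intro fspan_sum fspan_linear_image[OF Suc.IH])
    fix b s assume "s \<in> {lin_prod M | M :: (complex ^ 'n) multiset. size M = i}"
    then obtain M where "s = lin_prod M" "size M = i" by auto
    then show "(\<lambda>x. lin_form (m b) x * s x) \<in> fspan {lin_prod M | M. size M = Suc i}"
      by (intro fs.span_base) (auto intro!: exI[of _ "add_mset (m b) M"])
  qed
  ultimately show ?case by simp
qed

lemma limit_in_span_one_point:
  assumes "finite K" and T: "\<And>Z. (mom K c u Z \<longlongrightarrow> T Z) F" and q: "\<And>k. k \<in> K \<Longrightarrow> p k = q"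
    and "K \<noteq> {}"
  shows "(\<lambda>x. T (replicate_mset d x)) \<in>
    fspan {\<lambda>x. lin_form q x ^ (d - size M) * lin_prod M x | M. size M < card K \<and> size M \<le> d}"
    (is "_ \<in> fspan ?S")
proof -
  obtain k0 where k0: "k0 \<in> K" using assms(4) by auto
  have qy: "lin_form y q = 1"
  proof (rule tendsto_unique[OF F])
    show "((\<lambda>e. lin_form y (u k0 e)) \<longlongrightarrow> lin_form y q) F"
      using up[of k0] q[OF k0] by (intro tendsto_lin_form tendsto_const) simp
    show "((\<lambda>e. lin_form y (u k0 e)) \<longlongrightarrow> 1) F" by (simp add: uy)
  qed
  \<comment> \<open>This is the projection along \<open>y\<close> onto the kernel of
    \<open>q\<close>. Expanding \<open>x = \<rho> x + lin_form q x *s y\<close> binomially produces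
    the powers of \<open>q\<close>.\<close>
  define \<rho> where "\<rho> x = x - lin_form q x *s y" for x
  have \<rho>: "\<rho> x $ b = lin_form (axis b 1 - y $ b *s q) x" for x b
    by (simp add: \<rho>_def lin_form_diff lin_form_scale lin_form_axis)
  \<comment> \<open>The shifted vectors of \<open>mom_vanish\<close> tend to \<open>\<rho> x\<close>
    itself, because \<open>q\<close> vanishes on it and all points have the limit \<open>q\<close>.
    The remaining \<open>i - card K\<close> copies are kept fixed.\<close>
  have vanish: "T (replicate_mset i (\<rho> x)) = 0" if i: "i \<ge> card K" for i x
  proof (rule tendsto_unique[OF F])
    let ?z = "\<rho> x" and ?R = "replicate_mset (i - card K) (\<rho> x)"
    have "((\<lambda>e. mom K c u (image_mset (\<lambda>k. ?z - lin_form ?z (u k e) *s y) (mset_set K) + ?R) e)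
      \<longlongrightarrow> T (image_mset (\<lambda>k. ?z - lin_form ?z (p k) *s y) (mset_set K) + ?R)) F"
      using i by (intro mom_tendsto_moving[OF F T assms(1) _ refl] shift_tendsto)
    moreover have "lin_form ?z q = 0"
      using qy by (simp add: \<rho>_def lin_form_diff lin_form_scale lin_form_commute[of q])
    then have "image_mset (\<lambda>k. ?z - lin_form ?z (p k) *s y) (mset_set K) = image_mset (\<lambda>k. ?z) (mset_set K)"
      using assms(1) q by (intro image_mset_cong) auto
    moreover have "image_mset (\<lambda>k. ?z) (mset_set K) + ?R = replicate_mset i ?z"
      using i by (intro multiset_eqI) (simp add: image_mset_const_eq)
    ultimately show "((\<lambda>e. mom K c u (image_mset (\<lambda>k. ?z - lin_form ?z (u k e) *s y) (mset_set K) + ?R) e)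
      \<longlongrightarrow> T (replicate_mset i ?z)) F" by simp
    show "((\<lambda>e. mom K c u (image_mset (\<lambda>k. ?z - lin_form ?z (u k e) *s y) (mset_set K) + ?R) e) \<longlongrightarrow> 0) F"
      by (simp add: mom_vanish[OF assms(1)])
  qed
  have expand: "T (replicate_mset d x) =
      (\<Sum>i\<le>d. of_nat (d choose i) * (lin_form q x ^ (d - i) * T (replicate_mset i (\<rho> x))))" for x
  proof (rule tendsto_unique[OF F T])
    have "lin_form x (u k e) = lin_form (\<rho> x) (u k e) + lin_form q x" for k e
      by (simp add: \<rho>_def lin_form_diff lin_form_scale uy)
    then have "mom K c u (replicate_mset d x) e =
        (\<Sum>k\<in>K. \<Sum>i\<le>d. of_nat (d choose i) * (lin_form q x ^ (d - i) * (c k e * lin_form (\<rho> x) (u k e) ^ i)))" for e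
      by (simp add: mom_def binomial_ring sum_distrib_left mult_ac)
    also have "\<dots> e = (\<Sum>i\<le>d. of_nat (d choose i) * (lin_form q x ^ (d - i) * mom K c u (replicate_mset i (\<rho> x)) e))" for e
      by (subst sum.swap) (simp add: mom_def sum_distrib_left)
    finally have "mom K c u (replicate_mset d x) =
      (\<lambda>e. \<Sum>i\<le>d. of_nat (d choose i) * (lin_form q x ^ (d - i) * mom K c u (replicate_mset i (\<rho> x)) e))"
      by auto
    then show "(mom K c u (replicate_mset d x) \<longlongrightarrow>
      (\<Sum>i\<le>d. of_nat (d choose i) * (lin_form q x ^ (d - i) * T (replicate_mset i (\<rho> x))))) F"
      by (simp only:) (intro tendsto_intros T)
  qed
  have "(\<lambda>x. \<Sum>i\<le>d. of_nat (d choose i) * (lin_form q x ^ (d - i) * T (replicate_mset i (\<rho> x)))) \<in> fspan ?S"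
  proof (intro fspan_sum fspan_scale)
    fix i assume i: "i \<in> {..d}"
    show "(\<lambda>x. lin_form q x ^ (d - i) * T (replicate_mset i (\<rho> x))) \<in> fspan ?S"
    proof (cases "i < card K")
      case True
      show ?thesis
      proof (rule fspan_linear_image[where h = "\<lambda>x. x"])
        show "(\<lambda>x. T (replicate_mset i (\<rho> x))) \<in> fspan {lin_prod M | M. size M = i}"
          using limit_replicate_in_span[OF T \<rho>, where Z = "{#}"] by simp
        fix s assume "s \<in> {lin_prod M | M :: (complex ^ 'n) multiset. size M = i}"
        then show "(\<lambda>x. lin_form q x ^ (d - i) * s x) \<in> fspan ?S"
          using i True by (intro fs.span_base) auto
      qed
    next
      case False
      then show ?thesis by (simp add: vanish fspan_zero)
    qed
  qed
  then show ?thesis by (simp add: expand)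
qed

text \<open>Separating unequal limits reduces the family until a single limit is left. The
  generators of a smaller family remain available, since removing a point never raises a
  multiplicity.\<close>

lemma limit_in_span:
  assumes "finite K" "\<And>Z. (mom K c u Z \<longlongrightarrow> T Z) F"
  shows "(\<lambda>x. T (replicate_mset d x)) \<in> fspan {\<lambda>x. lin_form q x ^ (d - size M) * lin_prod M x | q M.
      q \<in> p ` K \<and> size M < card {k \<in> K. p k = q} \<and> size M \<le> d}"
  using assms
proof (induction "card K" arbitrary: K c T rule: less_induct)
  case less
  let ?S = "\<lambda>K. {\<lambda>x. lin_form q x ^ (d - size M) * lin_prod M x | q M.
      q \<in> p ` K \<and> size M < card {k \<in> K. p k = q} \<and> size M \<le> d}"
  note T = less.prems(2)
  consider "K = {}" | q where "K \<noteq> {}" "\<And>k. k \<in> K \<Longrightarrow> p k = q"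
    | k1 k2 where "k1 \<in> K" "k2 \<in> K" "p k1 \<noteq> p k2" by metis
  then show ?case
  proof cases
    case 1
    have "T Z = 0" for Z
      using T[of Z] F by (simp add: 1 mom_def[abs_def] tendsto_const_iff)
    then show ?thesis by (simp add: fspan_zero)
  next
    case (2 q)
    then have K: "{k \<in> K. p k = q} = K" "q \<in> p ` K" by auto
    have "(\<lambda>x. T (replicate_mset d x)) \<in>
        fspan {\<lambda>x. lin_form q x ^ (d - size M) * lin_prod M x | M. size M < card K \<and> size M \<le> d}"
      using 2 by (intro limit_in_span_one_point[OF less.prems(1) T]) auto
    then show ?thesis
    proof (rule fspan_trans)
      fix s assume "s \<in> {\<lambda>x. lin_form q x ^ (d - size M) * lin_prod M x | M. size M < card K \<and> size M \<le> d}"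
      then obtain M where "s = (\<lambda>x. lin_form q x ^ (d - size M) * lin_prod M x)" "size M < card K" "size M \<le> d"
        by blast
      with K show "s \<in> fspan (?S K)"
        by (intro fs.span_base CollectI exI[of _ q] exI[of _ M]) simp
    qed
  next
    case (3 k1 k2)
    then obtain b where b: "p k1 $ b \<noteq> p k2 $ b" by (auto simp: vec_eq_iff)
    \<comment> \<open>Multiplying the weights by \<open>u k $ b - u j $ b\<close> removes the point \<open>j\<close>; for two points with
      different limits, the difference of the two reduced families is a nonzero multiple of the original one.\<close>
    define c' where "c' j k e = c k e * (u k e $ b - u j e $ b)" for j k e
    define T' where "T' j Z = T (add_mset (axis b 1) Z) - p j $ b * T Z" for j Z
    have mom': "mom (K - {j}) (c' j) u Z e = mom K c u (add_mset (axis b 1) Z) e - u j e $ b * mom K c u Z e"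
      if "j \<in> K" for j Z e
    proof -
      have "mom (K - {j}) (c' j) u Z e = mom K (c' j) u Z e"
        unfolding mom_def using less.prems(1) that by (simp add: sum.remove[of K j] c'_def)
      then show ?thesis
        by (simp add: mom_def c'_def lin_form_axis algebra_simps sum_distrib_left sum_subtractf)
    qed
    have lim': "(mom (K - {j}) (c' j) u Z \<longlongrightarrow> T' j Z) F" if "j \<in> K" for j Z
      unfolding mom'[OF that, abs_def] T'_def by (intro tendsto_intros T up)
    have "(\<lambda>x. T' j (replicate_mset d x)) \<in> fspan (?S K)" if "j \<in> K" for j
    proof -
      have "card (K - {j}) < card K" using that less.prems(1) by (intro card_Diff1_less)
      from less.hyps[OF this _ lim'[OF that]] less.prems(1)
      have "(\<lambda>x. T' j (replicate_mset d x)) \<in> fspan (?S (K - {j}))" by simp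
      moreover have "?S (K - {j}) \<subseteq> ?S K"
      proof -
        have "card {k \<in> K - {j}. p k = q} \<le> card {k \<in> K. p k = q}" for q
          using less.prems(1) by (intro card_mono) auto
        then show ?thesis using order.strict_trans2 by blast
      qed
      ultimately show ?thesis using fs.span_mono by blast
    qed
    then have "(\<lambda>x. 1 / (p k2 $ b - p k1 $ b) * (T' k1 (replicate_mset d x) - T' k2 (replicate_mset d x))) \<in> fspan (?S K)"
      using 3 by (intro fspan_scale fspan_diff) auto
    moreover have "T Z = 1 / (p k2 $ b - p k1 $ b) * (T' k1 Z - T' k2 Z)" for Z
      using b by (simp add: T'_def field_simps)
    ultimately show ?thesis by simp
  qed
qed

end

subsection \<open>Reduction to \<open>r\<close> variables\<close>

lemma norm_lin_form_le:
  fixes a x :: "complex ^ 'n"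
  assumes "\<And>i. norm (a $ i) \<le> A" "\<And>i. norm (x $ i) \<le> B" "0 \<le> A"
  shows "norm (lin_form a x) \<le> real CARD('n) * (A * B)"
proof -
  have "norm (lin_form a x) \<le> (\<Sum>i\<in>(UNIV :: 'n set). A * B)"
    unfolding lin_form_def using assms
    by (intro order_trans[OF norm_sum] sum_mono) (auto simp: norm_mult intro!: mult_mono)
  then show ?thesis by simp
qed

text \<open>Gaussian elimination, pivoting on an entry of maximal modulus; the point is that the bound on
  \<open>w\<close> and \<open>v\<close> does not depend on \<open>l\<close>.\<close>

lemma bounded_factorization:
  "\<exists>B. \<forall>l :: nat \<Rightarrow> complex ^ 'n. \<exists>w v. (\<forall>i j. norm (w i $ j) \<le> B \<and> norm (v i $ j) \<le> B) \<and>
    (\<forall>k<r. \<forall>x. lin_form (l k) x = (\<Sum>i<r. lin_form (l k) (v i) * lin_form (w i) x))"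
proof (induction r)
  case 0
  show ?case by (intro exI[of _ 0] allI exI[of _ "\<lambda>_. 0"]) simp
next
  case (Suc r)
  then obtain B where B: "\<And>l :: nat \<Rightarrow> complex ^ 'n. \<exists>w v. (\<forall>i j. norm (w i $ j) \<le> B \<and> norm (v i $ j) \<le> B) \<and>
    (\<forall>k<r. \<forall>x. lin_form (l k) x = (\<Sum>i<r. lin_form (l k) (v i) * lin_form (w i) x))" by blast
  have B0: "0 \<le> B"
  proof -
    obtain w :: "nat \<Rightarrow> complex ^ 'n" where "\<And>i j. norm (w i $ j) \<le> B" using B by blast
    then show ?thesis using norm_ge_zero order_trans by blast
  qed
  \<comment> \<open>The last summand bounds the correction in \<open>w1\<close> below:
    \<open>r\<close> terms, each a value of \<open>lin_form w0 (v i)\<close> times an entry of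
    \<open>w i\<close>.\<close>
  define B' where "B' = 1 + B + real r * (real CARD('n) * (1 * B) * B)"
  have B': "1 \<le> B'" "B \<le> B'" "1 + real r * (real CARD('n) * (1 * B) * B) \<le> B'"
    using B0 by (auto simp: B'_def)
  show ?case
  proof (intro exI[of _ B'] allI)
    fix l :: "nat \<Rightarrow> complex ^ 'n"
    define m where "m = Max (range (\<lambda>j. norm (l r $ j)))"
    have "m \<in> range (\<lambda>j. norm (l r $ j))" unfolding m_def by (rule Max_in) auto
    then obtain a where a: "m = norm (l r $ a)" by auto
    have max: "norm (l r $ j) \<le> norm (l r $ a)" for j
      unfolding a[symmetric] m_def by (rule Max_ge) auto
    \<comment> \<open>If \<open>l r\<close> is zero, division by zero gives \<open>w0 = 0\<close>,
      and the equation \<open>lr\<close> still holds.\<close>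
    define w0 where "w0 = (1 / (l r $ a)) *s l r"
    have w0_le: "norm (w0 $ j) \<le> 1" for j
      using max[of j] by (cases "l r $ a = 0") (auto simp: w0_def norm_divide divide_simps)
    have lr: "l r = (l r $ a) *s w0"
      using max by (cases "l r $ a = 0") (auto simp: w0_def vec_eq_iff)
    define l' where "l' k = l k - (l k $ a) *s w0" for k
    obtain w v where wv: "\<And>i j. norm (w i $ j) \<le> B" "\<And>i j. norm (v i $ j) \<le> B"
      "\<And>k x. k < r \<Longrightarrow> lin_form (l' k) x = (\<Sum>i<r. lin_form (l' k) (v i) * lin_form (w i) x)"
      using B[of l'] by blast
    \<comment> \<open>Elimination turns the pivot form into zero, so the factorisation of the first
      \<open>r\<close> reduced forms also covers the index \<open>r\<close>.\<close>
    have l'_eq: "lin_form (l' k) x = (\<Sum>i<r. lin_form (l' k) (v i) * lin_form (w i) x)" if "k < Suc r" for k x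
    proof (cases "k = r")
      case True
      then have "l' k = 0" using lr by (simp add: l'_def)
      then show ?thesis by (simp add: lin_form_zero)
    qed (use wv(3) that in auto)
    \<comment> \<open>Substituting \<open>l' k\<close> into its factorisation and collecting the
      multiples of \<open>l k $ a\<close> leaves exactly this form; its partner is the coordinate
      vector at the pivot.\<close>
    define w1 where "w1 = w0 - (\<Sum>i<r. lin_form w0 (v i) *s w i)"
    have w1_le: "norm (w1 $ j) \<le> B'" for j
    proof -
      have "norm (w1 $ j) \<le> norm (w0 $ j) + norm (\<Sum>i<r. lin_form w0 (v i) * w i $ j)"
        by (simp add: w1_def norm_triangle_ineq4)
      also have "norm (\<Sum>i<r. lin_form w0 (v i) * w i $ j) \<le> (\<Sum>i<r. real CARD('n) * (1 * B) * B)"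
        using norm_lin_form_le[OF w0_le wv(2)] wv(1) B0
        by (intro order_trans[OF norm_sum] sum_mono) (auto simp: norm_mult intro!: mult_mono)
      finally show ?thesis using w0_le[of j] B' by simp
    qed
    have main: "lin_form (l k) x =
        (\<Sum>i<r. lin_form (l k) (v i) * lin_form (w i) x) + l k $ a * lin_form w1 x" if "k < Suc r" for k x
      using l'_eq[OF that, of x]
      by (simp add: l'_def w1_def lin_form_diff lin_form_scale lin_form_sum sum_subtractf sum_distrib_left algebra_simps)
    show "\<exists>w v. (\<forall>i j. norm (w i $ j) \<le> B' \<and> norm (v i $ j) \<le> B') \<and>
      (\<forall>k<Suc r. \<forall>x. lin_form (l k) x = (\<Sum>i<Suc r. lin_form (l k) (v i) * lin_form (w i) x))"
    proof (rule exI[of _ "w(r := w1)"], rule exI[of _ "v(r := axis a 1)"], intro conjI allI impI)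
      fix i j
      show "norm ((w(r := w1)) i $ j) \<le> B'" using wv(1) B' w1_le by (auto intro: order_trans)
      show "norm ((v(r := axis a 1)) i $ j) \<le> B'"
        using order_trans[OF wv(2) B'(2)] B' by (auto simp: axis_def)
    next
      fix k x assume "k < Suc r"
      moreover have "(\<Sum>i<r. lin_form (l k) ((v(r := axis a 1)) i) * lin_form ((w(r := w1)) i) x) =
          (\<Sum>i<r. lin_form (l k) (v i) * lin_form (w i) x)"
        by (intro sum.cong) auto
      ultimately show "lin_form (l k) x =
        (\<Sum>i<Suc r. lin_form (l k) ((v(r := axis a 1)) i) * lin_form ((w(r := w1)) i) x)"
        using main[of k x] by (simp add: lin_form_axis_right)
    qed
  qed
qed

section \<open>Choosing a common chart and polarising convergence\<close>

lemma exists_point_off_hyperplanes: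
  fixes v :: "nat \<Rightarrow> complex ^ 'n"
  assumes "finite K" "\<And>k. k \<in> K \<Longrightarrow> v k \<noteq> 0"
  shows "\<exists>y. \<forall>k\<in>K. lin_form (v k) y \<noteq> 0"
  using assms
proof (induction K rule: finite_induct)
  case empty
  then show ?case by simp
next
  case (insert j K)
  then obtain y where y: "\<And>k. k \<in> K \<Longrightarrow> lin_form (v k) y \<noteq> 0" by auto
  obtain a where a: "v j $ a \<noteq> 0" using insert.prems[of j] by (auto simp: vec_eq_iff)
  \<comment> \<open>Along this direction \<open>v j\<close> is not constant, and each of the
    finitely many forms vanishes for at most one parameter \<open>t\<close>.\<close>
  define z where "z = axis a (1 :: complex)"
  have lin: "lin_form (v k) (y + t *s z) = lin_form (v k) y + t * lin_form (v k) z" for k t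
    by (simp add: lin_form_commute[of "v k"] lin_form_add lin_form_scale)
  have zj: "lin_form (v j) z \<noteq> 0"
    using a by (simp add: z_def lin_form_axis_right)
  have "finite (\<Union>k\<in>insert j K. {t. lin_form (v k) (y + t *s z) = 0})"
  proof (intro finite_UN_I)
    fix k assume k: "k \<in> insert j K"
    show "finite {t. lin_form (v k) (y + t *s z) = 0}"
    proof (cases "lin_form (v k) z = 0")
      case True
      then have "k \<in> K" using k zj by auto
      then show ?thesis using y True by (simp add: lin)
    next
      case False
      then have "{t. lin_form (v k) (y + t *s z) = 0} \<subseteq> {- lin_form (v k) y / lin_form (v k) z}"
        by (auto simp: lin field_simps add_eq_0_iff2)
      then show ?thesis by (rule finite_subset) simp
    qed
  qed (use insert in auto)
  then obtain t where "t \<notin> (\<Union>k\<in>insert j K. {t. lin_form (v k) (y + t *s z) = 0})"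
    using ex_new_if_finite[OF infinite_UNIV_char_0] by blast
  then show ?case by auto
qed

text \<open>Products of \<open>d\<close> linear forms are combinations of powers, so convergence of
  the power sums carries over to all moments of degree \<open>d\<close>.\<close>

lemma mom_convergent_of_powers:
  assumes "\<And>x. \<exists>t. ((\<lambda>e. \<Sum>k\<in>K. c k e * lin_form x (u k e) ^ d) \<longlongrightarrow> t) F" "size Z = d"
  shows "\<exists>t. (mom K c u Z \<longlongrightarrow> t) F"
proof -
  have "(\<lambda>x. 1 * lin_prod Z x) \<in> fspan {\<lambda>x. 1 * lin_form m x ^ size Z | m. True}"
    by (rule lin_prod_in_span)
  then have "lin_prod Z \<in> fspan {\<lambda>x. lin_form m x ^ d | m. True}" by (simp add: assms(2))
  then have "\<exists>t. ((\<lambda>e. \<Sum>k\<in>K. c k e * lin_prod Z (u k e)) \<longlongrightarrow> t) F"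
  proof (induction rule: fs.span_induct_alt)
    case base
    then show ?case by auto
  next
    case (step a s g)
    then obtain m t1 t2 where s: "s = (\<lambda>x. lin_form m x ^ d)"
      and t1: "((\<lambda>e. \<Sum>k\<in>K. c k e * lin_form m (u k e) ^ d) \<longlongrightarrow> t1) F"
      and t2: "((\<lambda>e. \<Sum>k\<in>K. c k e * g (u k e)) \<longlongrightarrow> t2) F"
      using assms(1) by blast
    have "((\<lambda>e. a * (\<Sum>k\<in>K. c k e * lin_form m (u k e) ^ d) + (\<Sum>k\<in>K. c k e * g (u k e))) \<longlongrightarrow> a * t1 + t2) F"
      by (intro tendsto_intros t1 t2)
    then show ?case by (auto simp: s sum_distrib_left sum.distrib algebra_simps)
  qed
  then show ?thesis by (simp add: mom_def[abs_def])
qed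

subsection \<open>Limits of sums of powers along an ultrafilter\<close>

context
  fixes U :: "'e filter"
  assumes U: "U \<noteq> bot" "\<And>P. eventually P U \<or> eventually (\<lambda>x. \<not> P x) U"
begin

lemma ultrafilter_vec_convergent:
  fixes g :: "'e \<Rightarrow> complex ^ 'm"
  assumes "\<And>e j. norm (g e $ j) \<le> B"
  shows "\<exists>a. (g \<longlongrightarrow> a) U"
proof -
  have "\<exists>a. ((\<lambda>e. g e $ j) \<longlongrightarrow> a) U" for j
    using assms by (intro ultrafilter_bounded_convergent[OF U, of "cball 0 B"]) auto
  then obtain a where "\<And>j. ((\<lambda>e. g e $ j) \<longlongrightarrow> a j) U" by metis
  then have "(g \<longlongrightarrow> (\<chi> j. a j)) U" by (intro vec_tendstoI) simp
  then show ?thesis ..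
qed

text \<open>For each \<open>e\<close> the forms factor through a map \<open>\<pi> e\<close> of rank
  at most \<open>r\<close>. The uniform bound on its ingredients makes these maps converge along
  \<open>U\<close>, and the moments pass to the limit.\<close>

lemma limit_factors_through_rank_r:
  fixes l :: "nat \<Rightarrow> 'e \<Rightarrow> complex ^ 'n"
  assumes lim: "\<And>x. ((\<lambda>e. \<Sum>k<r. lin_form (l k e) x ^ d) \<longlongrightarrow> f x) U"
  shows "\<exists>w v. \<forall>x. f x = f (\<Sum>i<r. lin_form (w i) x *s v i)"
proof -
  obtain B where B: "\<And>m :: nat \<Rightarrow> complex ^ 'n. \<exists>w v. (\<forall>i j. norm (w i $ j) \<le> B \<and> norm (v i $ j) \<le> B) \<and>
    (\<forall>k<r. \<forall>x. lin_form (m k) x = (\<Sum>i<r. lin_form (m k) (v i) * lin_form (w i) x))"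
    using bounded_factorization by blast
  define P where "P e w v \<longleftrightarrow> (\<forall>i j. norm (w i $ j) \<le> B \<and> norm (v i $ j) \<le> B) \<and>
    (\<forall>k<r. \<forall>x. lin_form (l k e) x = (\<Sum>i<r. lin_form (l k e) (v i) * lin_form (w i) x))" for e w v
  have "\<exists>w v. P e w v" for e
    using B[of "\<lambda>k. l k e"] by (simp add: P_def)
  then obtain w v where "\<And>e. P e (w e) (v e)" by metis
  then have wv: "\<And>e i j. norm (w e i $ j) \<le> B" "\<And>e i j. norm (v e i $ j) \<le> B"
    "\<And>e k x. k < r \<Longrightarrow> lin_form (l k e) x = (\<Sum>i<r. lin_form (l k e) (v e i) * lin_form (w e i) x)"
    unfolding P_def by blast+
  have "\<exists>a. ((\<lambda>e. w e i) \<longlongrightarrow> a) U" "\<exists>a. ((\<lambda>e. v e i) \<longlongrightarrow> a) U" for i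
    by (rule ultrafilter_vec_convergent, rule wv)+
  then obtain w0 v0 where w0: "\<And>i. ((\<lambda>e. w e i) \<longlongrightarrow> w0 i) U" and v0: "\<And>i. ((\<lambda>e. v e i) \<longlongrightarrow> v0 i) U"
    by metis
  define \<pi> where "\<pi> e x = (\<Sum>i<r. lin_form (w e i) x *s v e i)" for e x
  define \<pi>0 where "\<pi>0 x = (\<Sum>i<r. lin_form (w0 i) x *s v0 i)" for x
  have \<pi>: "((\<lambda>e. \<pi> e x) \<longlongrightarrow> \<pi>0 x) U" for x
    unfolding \<pi>_def \<pi>0_def
    by (intro tendsto_sum tendsto_vector_scalar_mult tendsto_lin_form w0 v0 tendsto_const)
  have l\<pi>: "lin_form (\<pi> e x) (l k e) = lin_form x (l k e)" if "k < r" for e x k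
    using wv(3)[OF that, of e x]
    by (simp add: \<pi>_def lin_form_sum lin_form_scale lin_form_commute[of "l k e"] mult.commute)
  let ?mom = "mom {..<r} (\<lambda>_ _. 1) l"
  have rep: "?mom (replicate_mset d x) = (\<lambda>e. \<Sum>k<r. lin_form (l k e) x ^ d)" for x
    by (simp add: fun_eq_iff mom_def lin_form_commute[of x])
  have "\<exists>t. (?mom Z \<longlongrightarrow> t) U" if "size Z = d" for Z
  proof (rule mom_convergent_of_powers[OF _ that])
    show "\<exists>t. ((\<lambda>e. \<Sum>k<r. 1 * lin_form x (l k e) ^ d) \<longlongrightarrow> t) U" for x
      using lim[of x] by (auto simp: lin_form_commute[of x])
  qed
  then obtain T where T: "\<And>Z. size Z = d \<Longrightarrow> (?mom Z \<longlongrightarrow> T Z) U" by metis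
  have Tf: "T (replicate_mset d x) = f x" for x
    using tendsto_unique[OF U(1) T[of "replicate_mset d x"]] lim[of x] rep by simp
  have "f x = f (\<pi>0 x)" for x
  proof (rule tendsto_unique[OF U(1)])
    have "((\<lambda>e. ?mom (image_mset (\<lambda>i. \<pi> e x) (mset_set {..<d}) + {#}) e)
        \<longlongrightarrow> T (image_mset (\<lambda>i. \<pi>0 x) (mset_set {..<d}) + {#})) U"
      by (rule mom_tendsto_moving[OF U(1) T]) (use \<pi> in auto)
    then show "((\<lambda>e. ?mom (replicate_mset d (\<pi> e x)) e) \<longlongrightarrow> f (\<pi>0 x)) U"
      by (simp add: image_mset_const_eq Tf)
    have "?mom (replicate_mset d (\<pi> e x)) e = (\<Sum>k<r. lin_form (l k e) x ^ d)" for e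
      by (simp add: mom_def l\<pi> lin_form_commute[of x])
    then show "((\<lambda>e. ?mom (replicate_mset d (\<pi> e x)) e) \<longlongrightarrow> f x) U" using lim by simp
  qed
  then show ?thesis unfolding \<pi>0_def by blast
qed

text \<open>Forms of unit norm have nonzero limits. A vector \<open>y\<close> off the kernels of
  these limits is eventually off the kernels of the forms as well, and dividing by the value at
  \<open>y\<close> gives the chart.\<close>

lemma normalize_linear_forms:
  fixes l :: "nat \<Rightarrow> 'e \<Rightarrow> complex ^ 'n"
  shows "\<exists>y c u p. (\<forall>k e. lin_form y (u k e) = 1) \<and> (\<forall>k. (u k \<longlongrightarrow> p k) U) \<and>
    (\<forall>k<r. \<forall>\<^sub>F e in U. \<forall>x. lin_form (l k e) x ^ d = c k e * lin_form x (u k e) ^ d)"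
proof -
  \<comment> \<open>A coordinate vector replaces zero forms and indices outside the range, so that
    the norm is always \<open>1\<close>.\<close>
  define v where "v k e = sgn (if k < r \<and> l k e \<noteq> 0 then l k e else axis undefined 1)" for k e
  have norm_v: "norm (v k e) = 1" for k e
    by (simp add: v_def norm_sgn axis_eq_0_iff)
  have l_v: "lin_form (l k e) x = of_real (norm (l k e)) * lin_form (v k e) x" if "k < r" for k e x
    using that by (cases "l k e = 0")
      (simp_all add: v_def lin_form_zero lin_form_def sgn_div_norm scaleR_conv_of_real[of _ "_ :: complex"] sum_distrib_left flip: mult.assoc)
  have "\<exists>a. (v k \<longlongrightarrow> a) U" for k
    by (rule ultrafilter_bounded_convergent[OF U, of "cball 0 1"]) (simp_all add: norm_v)
  then obtain v0 where v0: "\<And>k. (v k \<longlongrightarrow> v0 k) U" by metis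
  have "norm (v0 k) = 1" for k
    using tendsto_unique[OF U(1) tendsto_norm[OF v0]] by (simp add: norm_v)
  then have "v0 k \<noteq> 0" for k by (metis norm_zero zero_neq_one)
  then obtain y where y: "\<And>k. k \<le> r \<Longrightarrow> lin_form (v0 k) y \<noteq> 0"
    using exists_point_off_hyperplanes[of "{..r}" v0] by auto
  \<comment> \<open>The index \<open>r\<close> stands in for all larger ones, which is why
    \<open>y\<close> avoids the kernels for \<open>k \<le> r\<close>. The first branch keeps the
    value at \<open>y\<close> equal to \<open>1\<close> even where the normalisation would divide by
    zero.\<close>
  define u where "u k e = (if lin_form (v (min k r) e) y = 0 then (1 / lin_form (v0 (min k r)) y) *s v0 (min k r)
    else (1 / lin_form (v (min k r) e) y) *s v (min k r) e)" for k e
  define p where "p k = (1 / lin_form (v0 (min k r)) y) *s v0 (min k r)" for k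
  define c where "c k e = (of_real (norm (l k e)) * lin_form (v k e) y) ^ d" for k e
  have ne: "\<forall>\<^sub>F e in U. lin_form (v (min k r) e) y \<noteq> 0" for k
    using y by (intro tendsto_imp_eventually_ne[OF tendsto_lin_form[OF v0 tendsto_const]]) auto
  have "lin_form y (u k e) = 1" for k e
    using y by (auto simp: u_def lin_form_commute[of y] lin_form_scale)
  moreover have "(u k \<longlongrightarrow> p k) U" for k
  proof (rule Lim_transform_eventually)
    show "((\<lambda>e. (1 / lin_form (v (min k r) e) y) *s v (min k r) e) \<longlongrightarrow> p k) U"
      unfolding p_def using y
      by (intro tendsto_vector_scalar_mult tendsto_divide tendsto_lin_form v0 tendsto_const) auto
    show "\<forall>\<^sub>F e in U. (1 / lin_form (v (min k r) e) y) *s v (min k r) e = u k e"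
      using ne[of k] by eventually_elim (simp add: u_def)
  qed
  moreover have "\<forall>\<^sub>F e in U. \<forall>x. lin_form (l k e) x ^ d = c k e * lin_form x (u k e) ^ d" if "k < r" for k
    using ne[of k]
  proof eventually_elim
    case (elim e)
    show ?case
    proof
      fix x
      have "lin_form (l k e) x = (of_real (norm (l k e)) * lin_form (v k e) y) * lin_form x (u k e)"
        using elim that l_v[OF that, of e x] by (simp add: u_def lin_form_commute[of x] lin_form_scale)
      then show "lin_form (l k e) x ^ d = c k e * lin_form x (u k e) ^ d"
        by (simp add: c_def power_mult_distrib)
    qed
  qed
  ultimately show ?thesis by blast
qed

lemma limit_in_span_of_points:
  fixes l :: "nat \<Rightarrow> 'e \<Rightarrow> complex ^ 'n"
  assumes lim: "\<And>x. ((\<lambda>e. \<Sum>k<r. lin_form (l k e) x ^ d) \<longlongrightarrow> f x) U"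
    and "r \<le> Suc d"
  shows "\<exists>p. f \<in> fspan {\<lambda>x. lin_form q x ^ (d - size M) * lin_prod M x | q M.
      q \<in> p ` {..<r} \<and> size M < card {k \<in> {..<r}. p k = q} \<and> size M \<le> d}"
proof -
  obtain y c u p where uy: "\<And>k e. lin_form y (u k e) = 1" and up: "\<And>k. (u k \<longlongrightarrow> p k) U"
    and lu: "\<And>k. k < r \<Longrightarrow> \<forall>\<^sub>F e in U. \<forall>x. lin_form (l k e) x ^ d = c k e * lin_form x (u k e) ^ d"
    using normalize_linear_forms[of r l d] by blast
  have lim': "((\<lambda>e. \<Sum>k<r. c k e * lin_form x (u k e) ^ d) \<longlongrightarrow> f x) U" for x
  proof (rule Lim_transform_eventually[OF lim])
    have "\<forall>\<^sub>F e in U. \<forall>k\<in>{..<r}. \<forall>x. lin_form (l k e) x ^ d = c k e * lin_form x (u k e) ^ d"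
      using lu by (intro eventually_ball_finite) auto
    then show "\<forall>\<^sub>F e in U. (\<Sum>k<r. lin_form (l k e) x ^ d) = (\<Sum>k<r. c k e * lin_form x (u k e) ^ d)"
      by eventually_elim simp
  qed
  have conv: "\<exists>t. (mom {..<r} c u Z \<longlongrightarrow> t) U" if "size Z = d" for Z
    by (rule mom_convergent_of_powers[OF _ that]) (rule exI, rule lim')
  \<comment> \<open>Here \<open>r \<le> Suc d\<close> enters: convergence in degree \<open>d\<close>
    then forces convergence in all degrees.\<close>
  have "\<exists>t. (mom {..<r} c u Z \<longlongrightarrow> t) U" for Z
    by (rule mom_convergent_all[OF U(1) uy up, where d = d]) (simp_all add: assms(2) conv)
  then obtain T where T: "\<And>Z. (mom {..<r} c u Z \<longlongrightarrow> T Z) U" by metis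
  have "T (replicate_mset d x) = f x" for x
    using tendsto_unique[OF U(1) T[of "replicate_mset d x"]] lim'[of x] by (simp add: mom_def[abs_def])
  then show ?thesis
    using limit_in_span[OF U(1) uy up finite_lessThan T, where d = d] by auto
qed

end

subsection \<open>Waring decompositions\<close>

text \<open>Coefficients are absorbed into the forms by complex \<open>d\<close>-th roots.\<close>

lemma waring_decomp_of_scaled_powers:
  assumes "d \<ge> 1"
  shows "waring_decomp d (\<lambda>x. \<Sum>k<s. c k * lin_form (l k) x ^ d) s"
proof -
  have "\<exists>z. z ^ d = c k" for k
    using exists_complex_root[of d "c k"] assms by (metis not_one_le_zero)
  then obtain z where z: "\<And>k. z k ^ d = c k" by metis
  show ?thesis unfolding waring_decomp_def
    by (intro exI[of _ "\<lambda>k. z k *s l k"]) (simp add: lin_form_scale power_mult_distrib z)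
qed

lemma waring_decomp_mono:
  assumes "waring_decomp d f s" "s \<le> t" "d \<ge> 1"
  shows "waring_decomp d f t"
proof -
  obtain l where l: "\<And>x. f x = (\<Sum>k<s. lin_form (l k) x ^ d)"
    using assms(1) by (auto simp: waring_decomp_def)
  \<comment> \<open>The padding by zero forms contributes nothing because
    \<open>d \<ge> 1\<close>.\<close>
  have "(\<Sum>k<t. lin_form (if k < s then l k else 0) x ^ d) = (\<Sum>k<s. lin_form (if k < s then l k else 0) x ^ d)" for x
    using assms by (intro sum.mono_neutral_right) (auto simp: lin_form_zero)
  then show ?thesis unfolding waring_decomp_def
    by (intro exI[of _ "\<lambda>k. if k < s then l k else 0"]) (simp add: l)
qed

lemma waring_decomp_add:
  assumes "waring_decomp d f s" "waring_decomp d g t"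
  shows "waring_decomp d (\<lambda>x. f x + g x) (s + t)"
proof -
  obtain l m where l: "\<And>x. f x = (\<Sum>k<s. lin_form (l k) x ^ d)" and m: "\<And>x. g x = (\<Sum>k<t. lin_form (m k) x ^ d)"
    using assms by (auto simp: waring_decomp_def)
  have "(\<Sum>k<s + t. lin_form (if k < s then l k else m (k - s)) x ^ d) =
      (\<Sum>k<s. lin_form (l k) x ^ d) + (\<Sum>k<t. lin_form (m k) x ^ d)" for x
    by (induction t) simp_all
  then show ?thesis unfolding waring_decomp_def
    by (intro exI[of _ "\<lambda>k. if k < s then l k else m (k - s)"]) (simp add: l m)
qed

lemma waring_decomp_sum:
  assumes "finite B" "\<And>b. b \<in> B \<Longrightarrow> waring_decomp d (g b) s"
  shows "waring_decomp d (\<lambda>x. \<Sum>b\<in>B. g b x) (card B * s)"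
  using assms
proof (induction B rule: finite_induct)
  case empty
  then show ?case by (simp add: waring_decomp_def)
next
  case (insert b B)
  then show ?case using waring_decomp_add[of d "g b" s "\<lambda>x. \<Sum>b\<in>B. g b x" "card B * s"] by simp
qed

text \<open>A basis chosen inside \<open>S\<close> has at most \<open>card X\<close> elements. Thus
  \<open>X\<close> only bounds the dimension, while the cost per summand is that of an element of
  \<open>S\<close>.\<close>

lemma waring_decomp_of_span:
  assumes "f \<in> fspan S" "\<And>s c. s \<in> S \<Longrightarrow> waring_decomp d (\<lambda>x. c * s x) n"
    and "finite X" "S \<subseteq> fspan X" "d \<ge> 1"
  shows "waring_decomp d f (card X * n)"
proof -
  obtain B where B: "B \<subseteq> S" "fs.independent B" "S \<subseteq> fspan B"
    using fs.maximal_independent_subset[of S] by blast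
  then have fin: "finite B" "card B \<le> card X"
    using fs.independent_span_bound[OF assms(3), of B] assms(4) by auto
  have "f \<in> fspan B" using assms(1) B(3) by (meson fspan_trans subsetD)
  then obtain a where f: "f = (\<Sum>b\<in>B. (\<lambda>x. a b * b x))"
    using fs.span_finite[OF fin(1)] by auto
  have "(\<Sum>b\<in>B. (\<lambda>x. a b * b x)) = (\<lambda>x. \<Sum>b\<in>B. a b * b x)"
    using fin(1) by (induction B rule: finite_induct) auto
  then have "waring_decomp d f (card B * n)"
    using waring_decomp_sum[OF fin(1), of d "\<lambda>b x. a b * b x" n] assms(2) B(1) f by auto
  then show ?thesis using fin(2) assms(5) by (elim waring_decomp_mono) auto
qed

text \<open>A roots of unity filter of order \<open>a + 1\<close> isolates the monomial in the binomial expansion.\<close>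

lemma binary_monomial_as_powers:
  fixes p m :: "complex ^ 'n"
  assumes "b \<le> a"
  shows "\<exists>c l. \<forall>x. lin_form p x ^ a * lin_form m x ^ b = (\<Sum>k<Suc a. c k * lin_form (l k) x ^ (a + b))"
proof -
  define N where "N = Suc a"
  define \<omega> where "\<omega> j = exp (2 * of_real pi * \<i> * of_nat j / of_nat N)" for j :: nat
  have N: "N > 0" by (simp add: N_def)
  have \<omega>_pow: "\<omega> k ^ j = \<omega> j ^ k" for j k
    by (simp add: \<omega>_def exp_of_nat_mult[symmetric] algebra_simps)
  have \<omega>_N: "\<omega> j ^ N = 1" for j
    using complex_root_unity[of N j] N by (simp add: \<omega>_def)
  have \<omega>_1: "\<omega> j = 1 \<longleftrightarrow> N dvd j" for j
    using complex_root_unity_eq[of N j 0] N by (simp add: \<omega>_def cong_def dvd_eq_mod_eq_0)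
  have filter: "(\<Sum>k<N. \<omega> k ^ j) = (if N dvd j then of_nat N else 0)" for j
  proof (cases "N dvd j")
    case True
    then show ?thesis by (simp add: \<omega>_pow[of _ j] \<omega>_1[THEN iffD2])
  next
    case False
    then have "\<omega> j \<noteq> 1" by (simp add: \<omega>_1)
    then have "(\<Sum>k<N. \<omega> j ^ k) = 0" by (simp add: geometric_sum \<omega>_N)
    then show ?thesis using False by (simp add: \<omega>_pow[of _ j])
  qed
  \<comment> \<open>The weight \<open>\<omega> k ^ (N - b)\<close> moves the exponent
    \<open>b\<close> to \<open>N\<close>; all shifted exponents lie strictly between
    \<open>0\<close> and \<open>2 * N\<close>, so no other multiple of \<open>N\<close>
    occurs.\<close>
  have dvd: "N dvd i + (N - b) \<longleftrightarrow> i = b" if "i \<le> a + b" for i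
  proof
    assume "N dvd i + (N - b)"
    then obtain t where t: "i + (N - b) = N * t" by (auto elim: dvdE)
    have "N * t < N * 2" and "N * t > 0" using that assms t by (auto simp: N_def)
    then have "t < 2" "t > 0" by auto
    then have "t = 1" by linarith
    then show "i = b" using t assms by (simp add: N_def)
  qed (use assms in \<open>simp add: N_def\<close>)
  define C where "C = (of_nat N * of_nat (a + b choose b) :: complex)"
  have C: "C \<noteq> 0" using N by (simp add: C_def)
  have "(\<Sum>k<N. \<omega> k ^ (N - b) * lin_form (\<omega> k *s m + p) x ^ (a + b)) = C * (lin_form p x ^ a * lin_form m x ^ b)" for x
  proof -
    have "(\<Sum>k<N. \<omega> k ^ (N - b) * lin_form (\<omega> k *s m + p) x ^ (a + b)) =
      (\<Sum>k<N. \<Sum>i\<le>a + b. of_nat (a + b choose i) * (lin_form m x ^ i * lin_form p x ^ (a + b - i)) * \<omega> k ^ (i + (N - b)))"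
      by (simp add: lin_form_add lin_form_scale binomial_ring power_mult_distrib power_add[of "\<omega> _"] sum_distrib_left mult_ac)
    also have "\<dots> = (\<Sum>i\<le>a + b. of_nat (a + b choose i) * (lin_form m x ^ i * lin_form p x ^ (a + b - i)) * (\<Sum>k<N. \<omega> k ^ (i + (N - b))))"
      by (subst sum.swap) (simp add: sum_distrib_left)
    also have "\<dots> = (\<Sum>i\<le>a + b. if i = b then of_nat (a + b choose i) * (lin_form m x ^ i * lin_form p x ^ (a + b - i)) * of_nat N else 0)"
      by (intro sum.cong) (auto simp: filter dvd)
    also have "\<dots> = C * (lin_form p x ^ a * lin_form m x ^ b)"
      by (simp add: C_def)
    finally show ?thesis .
  qed
  then have "lin_form p x ^ a * lin_form m x ^ b =
      (\<Sum>k<Suc a. (\<omega> k ^ (N - b) / C) * lin_form (\<omega> k *s m + p) x ^ (a + b))" for x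
    using C unfolding N_def[symmetric] by (simp add: sum_divide_distrib[symmetric])
  then show ?thesis
    by (intro exI[of _ "\<lambda>k. \<omega> k ^ (N - b) / C"] exI[of _ "\<lambda>k. \<omega> k *s m + p"]) blast
qed

lemma waring_decomp_binary_monomial:
  assumes "d \<ge> 1" "a + b = d"
  shows "waring_decomp d (\<lambda>x. c * (lin_form p x ^ a * lin_form m x ^ b)) d"
proof -
  have *: "waring_decomp d (\<lambda>x. c * (lin_form p x ^ a * lin_form m x ^ b)) d"
    if ab: "a + b = d" "b \<le> a" for a b and p m :: "complex ^ 'b"
  \<comment> \<open>For \<open>b = 0\<close> the filter would use \<open>d + 1\<close> powers, but
    the form is already a scaled power. Otherwise \<open>Suc a \<le> d\<close>.\<close>
  proof (cases "b = 0")
    case True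
    then show ?thesis
      using waring_decomp_mono[OF waring_decomp_of_scaled_powers[OF assms(1), where s = 1 and c = "\<lambda>_. c" and l = "\<lambda>_. p"], of d]
        assms(1) ab by simp
  next
    case False
    obtain c' l where "\<And>x. lin_form p x ^ a * lin_form m x ^ b = (\<Sum>k<Suc a. c' k * lin_form (l k) x ^ (a + b))"
      using binary_monomial_as_powers[OF ab(2), of p m] by blast
    then have "(\<lambda>x. c * (lin_form p x ^ a * lin_form m x ^ b)) = (\<lambda>x. \<Sum>k<Suc a. (c * c' k) * lin_form (l k) x ^ d)"
      by (simp add: ab(1) sum_distrib_left mult.assoc del: sum.lessThan_Suc)
    then show ?thesis
      using waring_decomp_mono[OF waring_decomp_of_scaled_powers[OF assms(1), where s = "Suc a" and c = "\<lambda>k. c * c' k" and l = l], of d]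
        assms(1) ab False by simp
  qed
  show ?thesis
  proof (cases "b \<le> a")
    case False
    then show ?thesis using *[of b a m p] assms(2) by (simp add: mult.commute)
  qed (use * assms(2) in auto)
qed

section \<open>Monomials as spanning sets\<close>

lemma power_in_span_of_monomials:
  fixes w :: "nat \<Rightarrow> complex ^ 'n" and g :: "complex ^ 'n \<Rightarrow> complex"
  shows "(\<lambda>x. g x * lin_form (\<Sum>i<r. a i *s w i) x ^ e) \<in>
    fspan ((\<lambda>\<alpha> x. g x * lin_prod (image_mset w \<alpha>) x) ` multisets_of_size {..<r} e)"
proof (induction e)
  case 0
  show ?case by (intro fs.span_base) (auto simp: fun_eq_iff)
next
  case (Suc e)
  have "(\<lambda>x. \<Sum>i<r. a i * (lin_form (w i) x * (g x * lin_form (\<Sum>i<r. a i *s w i) x ^ e)))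
    \<in> fspan ((\<lambda>\<alpha> x. g x * lin_prod (image_mset w \<alpha>) x) ` multisets_of_size {..<r} (Suc e))"
  proof (intro fspan_sum fspan_scale fspan_linear_image[OF Suc.IH, where h = "\<lambda>x. x"])
    fix i s assume i: "i \<in> {..<r}" and "s \<in> (\<lambda>\<alpha> x. g x * lin_prod (image_mset w \<alpha>) x) ` multisets_of_size {..<r} e"
    then obtain \<alpha> where \<alpha>: "\<alpha> \<in> multisets_of_size {..<r} e" "s = (\<lambda>x. g x * lin_prod (image_mset w \<alpha>) x)" by auto
    then have "add_mset i \<alpha> \<in> multisets_of_size {..<r} (Suc e)"
      using i by (auto simp: multisets_of_size_def)
    moreover have "(\<lambda>x. lin_form (w i) x * s x) = (\<lambda>x. g x * lin_prod (image_mset w (add_mset i \<alpha>)) x)"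
      by (simp add: \<alpha> mult_ac)
    ultimately show "(\<lambda>x. lin_form (w i) x * s x) \<in>
        fspan ((\<lambda>\<alpha> x. g x * lin_prod (image_mset w \<alpha>) x) ` multisets_of_size {..<r} (Suc e))"
      by (intro fs.span_base) blast
  qed
  moreover have "(\<lambda>x. \<Sum>i<r. a i * (lin_form (w i) x * (g x * lin_form (\<Sum>i<r. a i *s w i) x ^ e))) =
      (\<lambda>x. g x * lin_form (\<Sum>i<r. a i *s w i) x ^ Suc e)"
    by (simp add: fun_eq_iff lin_form_sum[of "\<lambda>i. a i *s w i"] lin_form_scale sum_distrib_left sum_distrib_right mult_ac)
  ultimately show ?case by simp
qed

lemma card_image_multisets_of_size_le:
  "card (h ` multisets_of_size {..<r} e) \<le> (r + e - 1) choose e"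
  using card_image_le[OF finite_multisets_of_size, of "{..<r}" h e] by (simp add: card_multisets_of_size)

text \<open>A monomial is a product of coordinate forms, to which polarisation applies.\<close>

lemma is_form_in_span_of_powers:
  fixes f :: "complex ^ 'n \<Rightarrow> complex"
  assumes "is_form d f"
  shows "f \<in> fspan {\<lambda>x. lin_form m x ^ d | m. True}"
proof -
  obtain c where c: "f = (\<lambda>x. \<Sum>\<alpha>\<in>{\<alpha> :: 'n \<Rightarrow> nat. sum \<alpha> UNIV = d}. c \<alpha> * (\<Prod>i\<in>UNIV. (x $ i) ^ \<alpha> i))"
    using assms unfolding is_form_def by blast
  have "(\<lambda>x. \<Prod>i\<in>UNIV. (x $ i) ^ \<alpha> i) \<in> fspan {\<lambda>x. lin_form m x ^ d | m. True}"
    if "sum \<alpha> UNIV = d" for \<alpha> :: "'n \<Rightarrow> nat"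
  proof -
    define M where "M I = (\<Sum>i\<in>I. replicate_mset (\<alpha> i) (axis i (1 :: complex)))" for I :: "'n set"
    have "size (M I) = sum \<alpha> I \<and> lin_prod (M I) x = (\<Prod>i\<in>I. (x $ i) ^ \<alpha> i)" if "finite I" for I x
      using that by (induction I rule: finite_induct) (simp_all add: M_def lin_form_axis)
    then have "size (M UNIV) = d" "lin_prod (M UNIV) = (\<lambda>x. \<Prod>i\<in>UNIV. (x $ i) ^ \<alpha> i)"
      using that by auto
    then show ?thesis using lin_prod_in_span[of "\<lambda>_. 1" "M UNIV"] by simp
  qed
  then show ?thesis unfolding c by (intro fspan_sum fspan_scale) simp
qed

subsection \<open>Counting\<close>

text \<open>Passing from \<open>m\<close> to \<open>m + 1\<close> multiplies
  \<open>(s + m choose m) / (m + 1)\<close> by \<open>(s + m + 1) / (m + 2)\<close>, which is at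
  least \<open>1\<close> for \<open>s \<ge> 1\<close>.\<close>

lemma binomial_ratio_mono:
  assumes "s \<ge> 1" "n \<le> m"
  shows "Suc m * (s + n choose n) \<le> Suc n * (s + m choose m)"
  using assms(2)
proof (induction m rule: dec_induct)
  case base
  show ?case by simp
next
  case (step m)
  have absorb: "Suc m * (s + Suc m choose Suc m) = Suc (s + m) * (s + m choose m)"
    using Suc_times_binomial_eq[of "s + m" m] by (simp add: mult.commute)
  have "Suc m * (Suc (Suc m) * (s + n choose n)) = Suc (Suc m) * (Suc m * (s + n choose n))" by (rule mult.left_commute)
  also have "\<dots> \<le> Suc (s + m) * (Suc n * (s + m choose m))"
    using assms(1) by (intro mult_le_mono[OF _ step.IH]) simp
  also have "\<dots> = Suc m * (Suc n * (s + Suc m choose Suc m))"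
    using absorb by (metis mult.left_commute)
  finally show ?case by (simp only: Suc_mult_le_cancel1)
qed

text \<open>By the monotone ratio with \<open>s = r - 1\<close>, a point of multiplicity
  \<open>b q\<close> takes at most the share \<open>b q / r\<close> of the central binomial
  coefficient, and the shares add up to \<open>1\<close>.\<close>

lemma sum_binomial_le_central:
  fixes b :: "'a \<Rightarrow> nat"
  assumes "finite Q" "\<And>q. q \<in> Q \<Longrightarrow> b q \<ge> 1" "(\<Sum>q\<in>Q. b q) = r" "r \<ge> 1"
  shows "(\<Sum>q\<in>Q. (r + (b q - 1) - 1) choose (b q - 1)) \<le> (2 * r - 2) choose (r - 1)"
proof -
  have "r * ((r + (b q - 1) - 1) choose (b q - 1)) \<le> b q * ((2 * r - 2) choose (r - 1))" if "q \<in> Q" for q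
  proof -
    have le: "b q \<le> r" using member_le_sum[OF that, of b] assms by simp
    show ?thesis
    proof (cases "r = 1")
      case True
      then show ?thesis using assms(2)[OF that] le by simp
    next
      case False
      have "Suc (r - 1) = r" "Suc (b q - 1) = b q" "r - 1 + (b q - 1) = r + (b q - 1) - 1" "r - 1 + (r - 1) = 2 * r - 2"
        using assms(2)[OF that] assms(4) by auto
      moreover have "Suc (r - 1) * (r - 1 + (b q - 1) choose (b q - 1)) \<le> Suc (b q - 1) * (r - 1 + (r - 1) choose (r - 1))"
        using False assms(4) le by (intro binomial_ratio_mono) auto
      ultimately show ?thesis by (simp only:)
    qed
  qed
  then have "r * (\<Sum>q\<in>Q. (r + (b q - 1) - 1) choose (b q - 1)) \<le> (\<Sum>q\<in>Q. b q) * ((2 * r - 2) choose (r - 1))"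
    unfolding sum_distrib_left sum_distrib_right by (rule sum_mono)
  then show ?thesis using assms(3,4) by simp
qed

subsection \<open>Debordering\<close>

lemma border_decomp_imp_waring_decomp:
  fixes f :: "complex ^ 'n \<Rightarrow> complex"
  assumes "d \<ge> 1" "is_form d f" "border_decomp d f r" "r \<ge> 1"
  shows "waring_decomp d f (((2 * r - 2) choose (r - 1)) * d)"
proof -
  obtain l where l: "\<And>x. ((\<lambda>e. \<Sum>k<r. lin_form (l k e) x ^ d) \<longlongrightarrow> f x) (at (0::complex))"
    using assms(3) unfolding border_decomp_def by blast
  obtain U where U: "U \<le> at (0::complex)" "U \<noteq> bot" "\<And>P. eventually P U \<or> eventually (\<lambda>x. \<not> P x) U"
    using exists_ultrafilter[of "at (0::complex)"] by auto
  note lim = tendsto_mono[OF U(1) l]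
  obtain w v where wv: "\<And>x. f x = f (\<Sum>i<r. lin_form (w i) x *s v i)"
    using limit_factors_through_rank_r[OF U(2,3) lim] by blast
  define \<pi> where "\<pi> x = (\<Sum>i<r. lin_form (w i) x *s v i)" for x
  have f\<pi>: "f = (\<lambda>x. f (\<pi> x))" using wv by (auto simp: \<pi>_def)
  \<comment> \<open>This is the transpose of \<open>\<pi>\<close>: a form pulled back along
    \<open>\<pi>\<close> lies in the span of the \<open>w i\<close>.\<close>
  define w' where "w' m = (\<Sum>i<r. lin_form m (v i) *s w i)" for m
  have \<pi>: "lin_form m (\<pi> x) = lin_form (w' m) x" for m x
    by (simp add: \<pi>_def w'_def lin_form_sum lin_form_scale lin_form_commute[of m] mult.commute)
  show ?thesis
  proof (cases "d < r")
    case True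
    define X where "X = (\<lambda>\<alpha> x. lin_prod (image_mset w \<alpha>) x) ` multisets_of_size {..<r} d"
    have "(\<lambda>x. 1 * f (\<pi> x)) \<in> fspan {\<lambda>x. lin_form (w' m) x ^ d | m. True}"
      by (rule fspan_linear_image[OF is_form_in_span_of_powers[OF assms(2)]]) (auto simp: \<pi> intro!: fs.span_base)
    then have "f \<in> fspan {\<lambda>x. lin_form (w' m) x ^ d | m. True}" using f\<pi> by simp
    moreover have "waring_decomp d (\<lambda>x. c * s x) 1" if "s \<in> {\<lambda>x. lin_form (w' m) x ^ d | m. True}" for s c
      using that waring_decomp_of_scaled_powers[OF assms(1), where s = 1 and c = "\<lambda>_. c"] by auto
    moreover have "finite X" by (simp add: X_def finite_multisets_of_size)
    moreover have "{\<lambda>x. lin_form (w' m) x ^ d | m. True} \<subseteq> fspan X"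
      using power_in_span_of_monomials[where g = "\<lambda>_. 1" and r = r and w = w and e = d] by (auto simp: w'_def X_def)
    ultimately have "waring_decomp d f (card X * 1)" using assms(1) by (rule waring_decomp_of_span)
    moreover have "card X * 1 \<le> ((2 * r - 2) choose (r - 1)) * d"
    proof -
      have "card X \<le> (r + d - 1) choose d"
        unfolding X_def by (rule card_image_multisets_of_size_le)
      also have "\<dots> = (r + d - 1) choose (r - 1)"
        using assms(4) by (subst binomial_symmetric) auto
      also have "\<dots> \<le> (2 * r - 2) choose (r - 1)"
        using True by (intro binomial_right_mono) auto
      also have "\<dots> \<le> ((2 * r - 2) choose (r - 1)) * d" using assms(1) by simp
      finally show ?thesis by simp
    qed
    ultimately show ?thesis using assms(1) by (rule waring_decomp_mono)
  next
    case False
    then have "r \<le> Suc d" by simp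
    then obtain p where p: "f \<in> fspan {\<lambda>x. lin_form q x ^ (d - size M) * lin_prod M x | q M.
      q \<in> p ` {..<r} \<and> size M < card {k \<in> {..<r}. p k = q} \<and> size M \<le> d}"
      using limit_in_span_of_points[OF U(2,3) lim] by blast
    define b where "b q = card {k \<in> {..<r}. p k = q}" for q
    define Q where "Q = p ` {..<r}"
    have sum_b: "(\<Sum>q\<in>Q. b q) = r"
      using sum.group[of "{..<r}" Q p "\<lambda>_. 1 :: nat"] by (simp add: Q_def b_def)
    have b_ge: "b q \<ge> 1" if "q \<in> Q" for q
    proof -
      have "{k \<in> {..<r}. p k = q} \<noteq> {}" using that by (auto simp: Q_def)
      then show ?thesis by (simp add: b_def Suc_le_eq card_gt_0_iff)
    qed
    have b_le: "b q - 1 \<le> d" if "q \<in> Q" for q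
      using member_le_sum[OF that, of b] sum_b False by (simp add: Q_def)
    \<comment> \<open>\<open>S\<close> holds the binary forms that cost \<open>d\<close> powers
      each; \<open>X\<close> below holds the monomials that bound the dimension of their
      span.\<close>
    define S where "S = {\<lambda>x. lin_form (w' q) x ^ (d - (b q - 1)) * lin_form (w' m) x ^ (b q - 1) | q m. q \<in> Q}"
    define X where "X = (\<Union>q\<in>Q. (\<lambda>\<alpha> x. lin_form (w' q) x ^ (d - (b q - 1)) * lin_prod (image_mset w \<alpha>) x)
      ` multisets_of_size {..<r} (b q - 1))"
    have "f \<in> fspan {\<lambda>x. lin_form q x ^ (d - (b q - 1)) * lin_form m x ^ (b q - 1) | q m. q \<in> Q}" (is "_ \<in> fspan ?S0")
      using p
    proof (rule fspan_trans, elim CollectE exE conjE)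
      fix s q M
      assume s: "s = (\<lambda>x. lin_form q x ^ (d - size M) * lin_prod M x)" and q: "q \<in> p ` {..<r}"
        and M: "size M < card {k \<in> {..<r}. p k = q}" "size M \<le> d"
      \<comment> \<open>Padding with copies of \<open>q\<close> brings all generators at
        \<open>q\<close> to the same cofactor degree \<open>b q - 1\<close>, so that only one space
        of forms per point is counted.\<close>
      define M' where "M' = replicate_mset (b q - 1 - size M) q + M"
      have q: "q \<in> Q" using q by (simp add: Q_def)
      have size: "size M' = b q - 1" using M by (simp add: M'_def b_def)
      have "d - size M = (d - (b q - 1)) + (b q - 1 - size M)" using M b_le[OF q] by (simp add: b_def)
      then have "s = (\<lambda>x. lin_form q x ^ (d - (b q - 1)) * lin_prod M' x)"
        by (simp add: s M'_def power_add mult.assoc)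
      also have "\<dots> \<in> fspan {\<lambda>x. lin_form q x ^ (d - (b q - 1)) * lin_form m x ^ size M' | m. True}"
        by (rule lin_prod_in_span)
      also have "\<dots> \<subseteq> fspan ?S0" using q by (intro fs.span_mono) (auto simp: size)
      finally show "s \<in> fspan ?S0" .
    qed
    then have "(\<lambda>x. 1 * f (\<pi> x)) \<in> fspan S"
    proof (rule fspan_linear_image)
      fix s assume "s \<in> ?S0"
      then obtain q m where "q \<in> Q" "s = (\<lambda>x. lin_form q x ^ (d - (b q - 1)) * lin_form m x ^ (b q - 1))" by blast
      then have "(\<lambda>x. 1 * s (\<pi> x)) \<in> S" unfolding S_def mult_1 by (simp only: \<pi>) blast
      then show "(\<lambda>x. 1 * s (\<pi> x)) \<in> fspan S" by (rule fs.span_base)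
    qed
    then have "f \<in> fspan S" using f\<pi> by simp
    moreover have "waring_decomp d (\<lambda>x. c * s x) d" if "s \<in> S" for s c
      using that b_le assms(1) by (auto simp: S_def intro!: waring_decomp_binary_monomial)
    moreover have "finite X" by (auto simp: X_def Q_def)
    moreover have "S \<subseteq> fspan X"
    proof
      fix s assume "s \<in> S"
      then obtain q m where q: "q \<in> Q"
        and s: "s = (\<lambda>x. lin_form (w' q) x ^ (d - (b q - 1)) * lin_form (w' m) x ^ (b q - 1))"
        by (auto simp: S_def)
      have "s \<in> fspan ((\<lambda>\<alpha> x. lin_form (w' q) x ^ (d - (b q - 1)) * lin_prod (image_mset w \<alpha>) x)
          ` multisets_of_size {..<r} (b q - 1))"
        unfolding s w'_def[of m] by (rule power_in_span_of_monomials)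
      also have "\<dots> \<subseteq> fspan X" using q by (intro fs.span_mono) (auto simp: X_def)
      finally show "s \<in> fspan X" .
    qed
    ultimately have "waring_decomp d f (card X * d)" using assms(1) by (rule waring_decomp_of_span)
    moreover have "card X \<le> (2 * r - 2) choose (r - 1)"
    proof -
      have "card X \<le> (\<Sum>q\<in>Q. card ((\<lambda>\<alpha> x. lin_form (w' q) x ^ (d - (b q - 1)) * lin_prod (image_mset w \<alpha>) x)
          ` multisets_of_size {..<r} (b q - 1)))"
        unfolding X_def by (rule card_UN_le) (simp add: Q_def)
      also have "\<dots> \<le> (\<Sum>q\<in>Q. (r + (b q - 1) - 1) choose (b q - 1))"
        by (intro sum_mono card_image_multisets_of_size_le)
      also have "\<dots> \<le> (2 * r - 2) choose (r - 1)"
        using b_ge sum_b assms(4) by (intro sum_binomial_le_central) (auto simp: Q_def)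
      finally show ?thesis .
    qed
    ultimately show ?thesis using assms(1) by (elim waring_decomp_mono) auto
  qed
qed

section \<open>Existence of decompositions and the final bound\<close>

lemma waring_decomp_imp_border_decomp:
  assumes "waring_decomp d f s"
  shows "border_decomp d f s"
proof -
  obtain l where l: "\<And>x. f x = (\<Sum>k<s. lin_form (l k) x ^ d)"
    using assms by (auto simp: waring_decomp_def)
  have "rational_fun (\<lambda>e. a)" for a
    unfolding rational_fun_def by (intro exI[of _ "[:a:]"] exI[of _ 1]) simp
  then show ?thesis
    unfolding border_decomp_def by (intro exI[of _ "\<lambda>k e. l k"]) (auto simp: l)
qed

lemma is_form_imp_waring_decomp:
  assumes "d \<ge> 1" "is_form d f"
  shows "\<exists>s. waring_decomp d f s"
  using is_form_in_span_of_powers[OF assms(2)]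
proof (induction rule: fs.span_induct_alt)
  case base
  then show ?case by (auto simp: waring_decomp_def intro!: exI[of _ 0])
next
  case (step c s f)
  then obtain m n where "s = (\<lambda>x. lin_form m x ^ d)" "waring_decomp d f n" by blast
  then show ?case
    using waring_decomp_add[OF waring_decomp_of_scaled_powers[OF assms(1), where s = 1 and c = "\<lambda>_. c" and l = "\<lambda>_. m"], of f n]
    by (auto simp: plus_fun_def)
qed

theorem theorem14:
  fixes f :: "complex ^ 'n \<Rightarrow> complex" and d r :: nat
  assumes "d \<ge> 1"
    and "is_form d f"
    and "border_WR d f = r"
  shows "WR d f \<le> ((2 * r - 2) choose (r - 1)) * d"
proof -
  \<comment> \<open>Existence is what makes the \<open>LEAST\<close> in \<open>border_WR\<close>
    attained.\<close>
  have "\<exists>s. border_decomp d f s"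
    using is_form_imp_waring_decomp[OF assms(1,2)] waring_decomp_imp_border_decomp by blast
  then have r: "border_decomp d f r"
    using assms(3) LeastI_ex[of "border_decomp d f"] by (simp add: border_WR_def)
  have "waring_decomp d f (((2 * r - 2) choose (r - 1)) * d)"
  \<comment> \<open>For \<open>r = 0\<close> truncated subtraction turns the bound into
    \<open>d\<close>; the limit of empty sums is zero, so the bound still holds.\<close>
  proof (cases "r = 0")
    case True
    have "f x = 0" for x
      using r by (auto simp: True border_decomp_def tendsto_const_iff)
    then have "waring_decomp d f 0" by (simp add: waring_decomp_def)
    then show ?thesis using assms(1) by (elim waring_decomp_mono) auto
  next
    case False
    then show ?thesis using border_decomp_imp_waring_decomp[OF assms(1,2) r] by simp
  qed
  then show ?thesis unfolding WR_def by (rule Least_le)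
qed

end
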